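(* Let $\lambda>0$ be a constant. Let $V$ be a set of $n$ vertices with an arbitrary fixed partition $V=R\cup B$ where $|R| = n/2+\Delta$, and then draw an Erdős–Rényi random graph $G\sim G(n,p)$ on $V$. If $n-10\ge pn\ge (1+\lambda)\log n$ and $p\Delta\ge 10$, then majority dynamics on $G$ with initial coloring $(R,B)$ reaches a Red unanimity (all vertices Red) within time $O(\log_{pn} n)$ with probability at least \[ 1-O\!\left(\frac{1}{\min\{n,\,p\Delta^2\}}+n^{-\lambda/2}\right). \]
   Context: Majority dynamics on a simple undirected graph $G=(V,E)$ with initial coloring $(R,B)$ (a partition of $V$): on day $0$ the vertices of $R$ are Red and those of $B$ are Blue; on each day $t+1$ every vertex adopts the color held by the majority of its neighbors on day $t$, and keeps its day-$t$ color in case of a tie. $G(n,p)$ is the random graph on $n$ labelled vertices where each pair is an edge independently with probability $p$. Asymptotic notation is as $n\to\infty$ with $\lambda$ fixed. *)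

theory Defs
  imports "HOL-Probability.Probability" "HOL-Library.Ramsey"
begin

text \<open>A simple undirected graph on a vertex set \<open>V\<close> is given by its set of edges
  \<open>E \<subseteq> nsets V 2\<close>, i.e. a set of two-element subsets of \<open>V\<close>.\<close>

definition neighbors :: "'a set set \<Rightarrow> 'a \<Rightarrow> 'a set" where
  "neighbors E v = {u. {u, v} \<in> E}"

datatype color = Red | Blue

definition majority_step :: "'a set set \<Rightarrow> ('a \<Rightarrow> color) \<Rightarrow> 'a \<Rightarrow> color" where
  "majority_step E c v =
     (let r = card {u \<in> neighbors E v. c u = Red};
          b = card {u \<in> neighbors E v. c u = Blue}
      in if b < r then Red else if r < b then Blue else c v)"

text \<open>The coloring \<open>(R, B)\<close> of \<open>V = R \<union> B\<close> is determined on \<open>V\<close> by \<open>R\<close> alone. The values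
  outside \<open>V\<close> play no role, since only elements of \<open>V\<close> lie in edges.\<close>

definition initial_coloring :: "'a set \<Rightarrow> 'a \<Rightarrow> color" where
  "initial_coloring R v = (if v \<in> R then Red else Blue)"

definition majority_dynamics :: "'a set set \<Rightarrow> 'a set \<Rightarrow> nat \<Rightarrow> 'a \<Rightarrow> color" where
  "majority_dynamics E R t = (majority_step E ^^ t) (initial_coloring R)"

definition red_unanimity_within :: "'a set \<Rightarrow> 'a set set \<Rightarrow> 'a set \<Rightarrow> real \<Rightarrow> bool" where
  "red_unanimity_within V E R T \<longleftrightarrow>
     (\<exists>t. real t \<le> T \<and> (\<forall>v\<in>V. majority_dynamics E R t v = Red))"

text \<open>The random graph \<open>G(n, p)\<close> on the finite vertex set \<open>V\<close>, \<open>n = card V\<close>, as a distribution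
  on edge sets: one independent Bernoulli variable with parameter \<open>p\<close> for each pair of vertices.\<close>

definition erdos_renyi :: "'a set \<Rightarrow> real \<Rightarrow> 'a set set pmf" where
  "erdos_renyi V p =
     map_pmf (\<lambda>f. {e \<in> nsets V 2. f e})
       (Pi_pmf (nsets V 2) False (\<lambda>_. bernoulli_pmf p))"

end

theory Submission
  imports Defs "HOL-Real_Asymp.Real_Asymp"
begin

text \<open>
  On day 1 a vertex compares the number of its neighbours in \<open>R\<close> with that in \<open>B\<close>. Matching \<open>B\<close>
  with a part of \<open>R\<close> writes the difference as a symmetric unimodal random walk, of standard
  deviation at most \<open>\<surd>(pn)\<close>, shifted by an independent binomial of mean about \<open>2p\<Delta>\<close>; hence the
  vertex becomes Red with probability \<open>1/2 + \<Omega>(min(\<surd>(p/n) \<Delta>, 1))\<close>. The number of Red vertices on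
  day 1 has variance at most \<open>n/2\<close>: two vertices share only one potential edge, so their covariance
  is a product of two first-order Fourier coefficients, and Bessel's inequality bounds the sum of
  all of them. Chebyshev's inequality then yields a Red majority of \<open>n/2 + 2\<surd>(n/p)\<close> on day 1, which
  is where the error \<open>1 / min(n, p\<Delta>\<^sup>2)\<close> comes from.

  Everything later is deterministic, given a few properties of the graph obtained from exponential
  moments and union bounds over all pairs of vertex sets. Whatever the Red set of day 1 is, fewer
  than \<open>0.48 n\<close> vertices are Blue on day 2, and then \<open>O(1/p)\<close> on day 3. If all degrees are at least
  \<open>\<epsilon>pn\<close>, which fails with probability \<open>O(n powr (-\<lambda>/2))\<close>, then every vertex that is Blue on the next
  day has \<open>\<epsilon>pn/2\<close> Blue neighbours, and a Blue set of size \<open>b = O(1/p)\<close> has fewer than \<open>b/\<surd>(pn)\<close>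
  such vertices. So the Blue set vanishes after \<open>O(log\<^bsub>pn\<^esub> n)\<close> days.
\<close>

subsection \<open>Random subsets\<close>

text \<open>The expectation of \<open>h\<close> over a random subset of \<open>S\<close> that contains each element
  independently with probability \<open>p\<close>.\<close>

definition Esub :: "real \<Rightarrow> 'a set \<Rightarrow> ('a set \<Rightarrow> real) \<Rightarrow> real" where
  "Esub p S h = (\<Sum>F\<in>Pow S. p ^ card F * (1 - p) ^ card (S - F) * h F)"

lemma Esub_empty [simp]: "Esub p {} h = h {}"
  by (simp add: Esub_def)

lemma Esub_cong: "(\<And>F. F \<subseteq> S \<Longrightarrow> h F = g F) \<Longrightarrow> Esub p S h = Esub p S g"
  unfolding Esub_def by (intro sum.cong) auto

text \<open>Conditions on whether \<open>a\<close> is chosen. Many later facts about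
  \<open>Esub\<close> follow from this recursion by induction on the set.\<close>

lemma Esub_insert:
  assumes "finite S" "a \<notin> S"
  shows "Esub p (insert a S) h = p * Esub p S (\<lambda>F. h (insert a F)) + (1 - p) * Esub p S h"
proof -
  have inj: "inj_on (insert a) (Pow S)"
    using assms(2) by (auto simp: inj_on_def)
  have disj: "Pow S \<inter> insert a ` Pow S = {}"
    using assms(2) by auto
  have "Esub p (insert a S) h =
      (\<Sum>F\<in>Pow S. p ^ card F * (1 - p) ^ card (insert a S - F) * h F) +
      (\<Sum>F\<in>insert a ` Pow S. p ^ card F * (1 - p) ^ card (insert a S - F) * h F)"
    unfolding Esub_def Pow_insert using assms(1) disj by (intro sum.union_disjoint) auto
  also have "(\<Sum>F\<in>Pow S. p ^ card F * (1 - p) ^ card (insert a S - F) * h F) = (1 - p) * Esub p S h"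
    unfolding Esub_def sum_distrib_left
  proof (intro sum.cong refl)
    fix F assume F: "F \<in> Pow S"
    have "insert a S - F = insert a (S - F)" using F assms(2) by auto
    then have "card (insert a S - F) = Suc (card (S - F))"
      using assms by simp
    then show "p ^ card F * (1 - p) ^ card (insert a S - F) * h F =
        (1 - p) * (p ^ card F * (1 - p) ^ card (S - F) * h F)" by simp
  qed
  also have "(\<Sum>F\<in>insert a ` Pow S. p ^ card F * (1 - p) ^ card (insert a S - F) * h F) =
      p * Esub p S (\<lambda>F. h (insert a F))"
    unfolding Esub_def sum_distrib_left sum.reindex[OF inj]
  proof (intro sum.cong refl)
    fix F assume F: "F \<in> Pow S"
    have "insert a S - insert a F = S - F" using F assms(2) by auto
    moreover have "card (insert a F) = Suc (card F)"
      using F assms by (intro card_insert_disjoint) (auto intro: finite_subset)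
    ultimately show "((\<lambda>F. p ^ card F * (1 - p) ^ card (insert a S - F) * h F) \<circ> insert a) F =
        p * (p ^ card F * (1 - p) ^ card (S - F) * h (insert a F))" by simp
  qed
  finally show ?thesis by simp
qed

lemma Esub_add: "Esub p S (\<lambda>F. h F + g F) = Esub p S h + Esub p S g"
  unfolding Esub_def by (simp add: algebra_simps sum.distrib)

lemma Esub_cmult: "Esub p S (\<lambda>F. c * h F) = c * Esub p S h"
  unfolding Esub_def by (simp add: sum_distrib_left algebra_simps)

lemma Esub_diff: "Esub p S (\<lambda>F. h F - g F) = Esub p S h - Esub p S g"
  unfolding Esub_def by (simp add: algebra_simps sum_subtractf)

lemma Esub_sum: "Esub p S (\<lambda>F. \<Sum>i\<in>I. h i F) = (\<Sum>i\<in>I. Esub p S (h i))"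
  unfolding Esub_def by (simp add: sum_distrib_left) (rule sum.swap)

lemma Esub_const [simp]: "finite S \<Longrightarrow> Esub p S (\<lambda>_. c) = c"
  by (induction S rule: finite_induct) (simp_all add: Esub_insert algebra_simps)

lemma Esub_mono:
  assumes "0 \<le> p" "p \<le> 1" "\<And>F. F \<subseteq> S \<Longrightarrow> h F \<le> g F"
  shows "Esub p S h \<le> Esub p S g"
  unfolding Esub_def using assms by (intro sum_mono mult_left_mono) auto

lemma Esub_Un:
  assumes "finite S" "finite T" "S \<inter> T = {}"
  shows "Esub p (S \<union> T) h = Esub p S (\<lambda>F. Esub p T (\<lambda>G. h (F \<union> G)))"
  using assms
proof (induction S arbitrary: h rule: finite_induct)
  case (insert a S)
  then have "a \<notin> S \<union> T" "finite (S \<union> T)" by auto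
  then show ?case using insert
    by (simp add: Esub_insert)
qed simp

text \<open>The hypothesis \<open>h F = h (F \<inter> T)\<close> is how dependence on the elements
  of \<open>T\<close> alone is expressed; the other elements average out to 1.\<close>

lemma Esub_marginal:
  assumes "finite S" "T \<subseteq> S" "\<And>F. F \<subseteq> S \<Longrightarrow> h F = h (F \<inter> T)"
  shows "Esub p S h = Esub p T h"
proof -
  have S: "S = T \<union> (S - T)" using assms(2) by auto
  have fin: "finite T" "finite (S - T)" using assms by (auto intro: finite_subset)
  have "Esub p S h = Esub p T (\<lambda>F. Esub p (S - T) (\<lambda>G. h (F \<union> G)))"
    by (subst S, rule Esub_Un) (use fin in auto)
  also have "\<dots> = Esub p T (\<lambda>F. Esub p (S - T) (\<lambda>G. h F))"
  proof (intro Esub_cong)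
    fix F G assume "F \<subseteq> T" "G \<subseteq> S - T"
    then have "(F \<union> G) \<inter> T = F" "F \<union> G \<subseteq> S" using assms(2) by auto
    then show "h (F \<union> G) = h F" using assms(3)[of "F \<union> G"] by simp
  qed
  finally show ?thesis using fin by simp
qed

lemma Esub_image:
  assumes "finite S" "inj_on f S"
  shows "Esub p (f ` S) h = Esub p S (\<lambda>F. h (f ` F))"
  using assms by (induction S arbitrary: h rule: finite_induct) (simp_all add: Esub_insert)

lemma Esub_indep:
  assumes "finite S" "T \<subseteq> S" "U \<subseteq> S" "T \<inter> U = {}"
    and g: "\<And>F. F \<subseteq> S \<Longrightarrow> g F = g (F \<inter> T)" and h: "\<And>F. F \<subseteq> S \<Longrightarrow> h F = h (F \<inter> U)"
  shows "Esub p S (\<lambda>F. g F * h F) = Esub p S g * Esub p S h"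
proof -
  have fin: "finite T" "finite U" using assms by (auto intro: finite_subset)
  have "Esub p S (\<lambda>F. g F * h F) = Esub p (T \<union> U) (\<lambda>F. g F * h F)"
  proof (rule Esub_marginal)
    fix F assume F: "F \<subseteq> S"
    have "F \<inter> (T \<union> U) \<inter> T = F \<inter> T" "F \<inter> (T \<union> U) \<inter> U = F \<inter> U" by auto
    then show "g F * h F = g (F \<inter> (T \<union> U)) * h (F \<inter> (T \<union> U))"
      using F g[of F] h[of F] g[of "F \<inter> (T \<union> U)"] h[of "F \<inter> (T \<union> U)"] by (simp add: le_infI1)
  qed (use assms in auto)
  also have "\<dots> = Esub p T (\<lambda>F. Esub p U (\<lambda>G. g (F \<union> G) * h (F \<union> G)))"
    by (rule Esub_Un) (use fin assms in auto)
  also have "\<dots> = Esub p T (\<lambda>F. Esub p U (\<lambda>G. g F * h G))"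
  proof (intro Esub_cong)
    fix F G assume "F \<subseteq> T" "G \<subseteq> U"
    then have "(F \<union> G) \<inter> T = F" "(F \<union> G) \<inter> U = G" "F \<union> G \<subseteq> S" using assms by auto
    then show "g (F \<union> G) * h (F \<union> G) = g F * h G" using g[of "F \<union> G"] h[of "F \<union> G"] by simp
  qed
  also have "\<dots> = Esub p T g * Esub p U h"
    by (simp add: Esub_cmult mult.commute[of _ "Esub p U h"])
  also have "Esub p T g = Esub p S g"
    using Esub_marginal[of S T g p] assms by metis
  also have "Esub p U h = Esub p S h"
    using Esub_marginal[of S U h p] assms by metis
  finally show ?thesis .
qed

section \<open>The link with the random graph; moment and union bounds\<close>

text \<open>Turns every probability in the theorem into a finite sum over edge sets, so that no
  measure theory is needed afterwards.\<close>

lemma prob_erdos_renyi: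
  assumes "finite V" "0 \<le> p" "p \<le> 1"
  shows "measure_pmf.prob (erdos_renyi V p) A = Esub p (nsets V 2) (\<lambda>F. of_bool (F \<in> A))"
proof -
  let ?S = "nsets V 2"
  let ?P = "Pi_pmf ?S False (\<lambda>_. bernoulli_pmf p)"
  have fin: "finite ?S" using assms(1) by (rule finite_imp_finite_nsets)
  \<comment> \<open>The product distribution has the default value \<open>False\<close> off
    \<open>?S\<close>, so its support consists of indicator functions of subsets of
    \<open>?S\<close>, and the expectation becomes a finite sum.\<close>
  define X where "X = (\<lambda>F e. e \<in> F) ` Pow ?S"
  have sup: "set_pmf ?P \<subseteq> X"
  proof
    fix f assume "f \<in> set_pmf ?P"
    then have "f \<in> {f. \<forall>e. e \<notin> ?S \<longrightarrow> f e = False}"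
      using set_Pi_pmf_subset[OF fin] by (rule rev_subsetD)
    then have "{e. f e} \<subseteq> ?S" by auto
    then show "f \<in> X" by (auto simp: X_def intro!: image_eqI[where x = "{e. f e}"])
  qed
  have inj: "inj_on (\<lambda>F e. e \<in> F) (Pow ?S)" by (auto simp: inj_on_def fun_eq_iff)
  have "(\<lambda>f. of_bool ({e \<in> ?S. f e} \<in> A)) = (indicator ((\<lambda>f. {e \<in> ?S. f e}) -` A) :: _ \<Rightarrow> real)"
    by (auto simp: fun_eq_iff indicator_def)
  then have "measure_pmf.prob (erdos_renyi V p) A = measure_pmf.expectation ?P (\<lambda>f. of_bool ({e \<in> ?S. f e} \<in> A))"
    by (simp add: erdos_renyi_def)
  also have "\<dots> = (\<Sum>f\<in>X. of_bool ({e \<in> ?S. f e} \<in> A) * pmf ?P f)"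
    using sup fin by (subst integral_measure_pmf_real[where A = X]) (auto simp: X_def)
  also have "\<dots> = (\<Sum>F\<in>Pow ?S. of_bool (F \<in> A) * pmf ?P (\<lambda>e. e \<in> F))"
    unfolding X_def using inj
    by (subst sum.reindex) (auto intro!: sum.cong simp: Int_absorb1 Collect_conj_eq)
  also have "\<dots> = Esub p ?S (\<lambda>F. of_bool (F \<in> A))"
    unfolding Esub_def
  proof (intro sum.cong refl)
    fix F assume F: "F \<in> Pow ?S"
    have "pmf ?P (\<lambda>e. e \<in> F) = (\<Prod>e\<in>?S. pmf (bernoulli_pmf p) (e \<in> F))"
      using F fin by (intro pmf_Pi') auto
    also have "\<dots> = (\<Prod>e\<in>F. p) * (\<Prod>e\<in>?S - F. 1 - p)"
      using F fin assms by (subst prod.subset_diff[of F]) (auto intro!: prod.cong)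
    finally show "of_bool (F \<in> A) * pmf ?P (\<lambda>e. e \<in> F) = p ^ card F * (1 - p) ^ card (?S - F) * of_bool (F \<in> A)"
      by (simp add: mult.commute)
  qed
  finally show ?thesis .
qed

text \<open>Independence factorises the exponential moment into the terms
  \<open>1 + p * (exp (w e) - 1)\<close>, each bounded by \<open>1 + x \<le> exp x\<close>.\<close>

lemma Esub_exp_sum_le:
  assumes "finite S" "0 \<le> p" "p \<le> 1"
  shows "Esub p S (\<lambda>F. exp (\<Sum>e\<in>F. w e)) \<le> exp (p * (\<Sum>e\<in>S. exp (w e) - 1))"
proof -
  have "Esub p S (\<lambda>F. exp (\<Sum>e\<in>F. w e)) = (\<Prod>e\<in>S. 1 + p * (exp (w e) - 1))"
    using assms(1)
  proof (induction S rule: finite_induct)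
    case (insert a S)
    have "Esub p S (\<lambda>F. exp (\<Sum>e\<in>insert a F. w e)) = Esub p S (\<lambda>F. exp (w a) * exp (\<Sum>e\<in>F. w e))"
    proof (intro Esub_cong)
      fix F assume "F \<subseteq> S"
      then have "finite F" "a \<notin> F" using insert by (auto intro: finite_subset)
      then show "exp (\<Sum>e\<in>insert a F. w e) = exp (w a) * exp (\<Sum>e\<in>F. w e)" by (simp add: exp_add)
    qed
    then show ?case using insert by (simp add: Esub_insert Esub_cmult algebra_simps)
  qed simp
  also have "\<dots> \<le> (\<Prod>e\<in>S. exp (p * (exp (w e) - 1)))"
  proof (intro prod_mono conjI)
    fix e
    have "p * (exp (w e) - 1) \<ge> p * (-1)" using assms by (intro mult_left_mono) auto
    then show "0 \<le> 1 + p * (exp (w e) - 1)" using assms by linarith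
    show "1 + p * (exp (w e) - 1) \<le> exp (p * (exp (w e) - 1))" by (rule exp_ge_add_one_self)
  qed
  also have "\<dots> = exp (p * (\<Sum>e\<in>S. exp (w e) - 1))"
    using assms(1) by (simp add: exp_sum sum_distrib_left)
  finally show ?thesis .
qed

text \<open>Markov's inequality with an arbitrary dominating function: \<open>g\<close> is an
  exponential in the Chernoff bounds and a quadratic in Chebyshev's inequality.\<close>

lemma Esub_markov:
  assumes "0 \<le> p" "p \<le> 1" "\<And>F. F \<subseteq> S \<Longrightarrow> P F \<Longrightarrow> 1 \<le> g F" "\<And>F. F \<subseteq> S \<Longrightarrow> 0 \<le> g F"
  shows "Esub p S (\<lambda>F. of_bool (P F)) \<le> Esub p S g"
  using assms by (intro Esub_mono) auto

lemma Esub_union_bound: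
  assumes "0 \<le> p" "p \<le> 1" "finite I" "\<And>i. i \<in> I \<Longrightarrow> Esub p S (\<lambda>F. of_bool (P i F)) \<le> (c::real)"
  shows "Esub p S (\<lambda>F. of_bool (\<exists>i\<in>I. P i F)) \<le> real (card I) * c"
proof -
  have "Esub p S (\<lambda>F. of_bool (\<exists>i\<in>I. P i F)) \<le> Esub p S (\<lambda>F. \<Sum>i\<in>I. of_bool (P i F))"
  proof (intro Esub_mono)
    fix F
    show "(of_bool (\<exists>i\<in>I. P i F) :: real) \<le> (\<Sum>i\<in>I. of_bool (P i F))"
    proof (cases "\<exists>i\<in>I. P i F")
      case True
      then obtain i where i: "i \<in> I" "P i F" by auto
      then have "(1::real) = of_bool (P i F)" by simp
      also have "\<dots> \<le> (\<Sum>i\<in>I. of_bool (P i F))"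
        using i assms(3) by (intro member_le_sum) auto
      finally show ?thesis by simp
    qed (auto intro: sum_nonneg)
  qed (use assms in auto)
  also have "\<dots> = (\<Sum>i\<in>I. Esub p S (\<lambda>F. of_bool (P i F)))" by (rule Esub_sum)
  also have "\<dots> \<le> (\<Sum>i\<in>I. c)" using assms by (intro sum_mono)
  finally show ?thesis by simp
qed

subsection \<open>Variance of a sum of local functions of the random graph\<close>

text \<open>Up to the factor \<open>sqrt (p * (1 - p))\<close>, the p-biased Fourier coefficient of
  \<open>f\<close> at the singleton of \<open>e\<close>. Inserting and deleting \<open>e\<close>
  makes the integrand independent of whether \<open>F\<close> contains \<open>e\<close>.\<close>

definition influence :: "real \<Rightarrow> 'a set \<Rightarrow> ('a set \<Rightarrow> real) \<Rightarrow> 'a \<Rightarrow> real" where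
  "influence p S f e = Esub p S (\<lambda>F. f (insert e F) - f (F - {e}))"

lemma influence_remove:
  assumes "finite S" "e \<in> S"
  shows "influence p S f e = Esub p (S - {e}) (\<lambda>F. f (insert e F)) - Esub p (S - {e}) f"
proof -
  define T where "T = S - {e}"
  have T: "S = insert e T" "finite T" "e \<notin> T" using assms by (auto simp: T_def)
  have rem: "F - {e} = F" if "F \<subseteq> T" for F using that T(3) by auto
  have "Esub p T (\<lambda>F. f (insert e (insert e F)) - f (insert e F - {e})) =
      Esub p T (\<lambda>F. f (insert e F) - f F)"
    "Esub p T (\<lambda>F. f (insert e F) - f (F - {e})) = Esub p T (\<lambda>F. f (insert e F) - f F)"
    by (auto intro!: Esub_cong simp: rem)
  then show ?thesis
    unfolding influence_def T_def[symmetric] T(1) using T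
    by (simp add: Esub_insert Esub_diff algebra_simps)
qed

text \<open>Bessel's inequality for the Fourier coefficients of degree one.\<close>

lemma sum_influence_sq_le_variance:
  assumes "finite S" "0 \<le> p" "p \<le> 1"
  shows "(\<Sum>e\<in>S. p * (1 - p) * (influence p S f e)\<^sup>2) \<le> Esub p S (\<lambda>F. (f F)\<^sup>2) - (Esub p S f)\<^sup>2"
  using assms(1)
proof (induction S arbitrary: f rule: finite_induct)
  case (insert a S)
  define g where "g F = f (insert a F)" for F
  have inf: "influence p (insert a S) f e = p * influence p S g e + (1 - p) * influence p S f e"
    if "e \<in> S" for e
  proof -
    have "insert a F - {e} = insert a (F - {e})" for F using that insert by auto
    then show ?thesis unfolding influence_def g_def using insert
      by (simp add: Esub_insert insert_commute)
  qed
  have infa: "influence p (insert a S) f a = Esub p S g - Esub p S f"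
    using insert by (simp add: influence_remove g_def[abs_def])
  \<comment> \<open>Once the status of \<open>a\<close> is fixed, each other influence is a mixture
    of the influences of the two restrictions \<open>g\<close> and \<open>f\<close>; convexity of
    the square lets the induction hypothesis act on each restriction.\<close>
  have convex: "(p * x + (1 - p) * y)\<^sup>2 \<le> p * x\<^sup>2 + (1 - p) * y\<^sup>2" for x y
  proof -
    have "p * x\<^sup>2 + (1 - p) * y\<^sup>2 - (p * x + (1 - p) * y)\<^sup>2 = p * (1 - p) * (x - y)\<^sup>2"
      by (simp add: power2_eq_square algebra_simps)
    also have "\<dots> \<ge> 0" using assms by simp
    finally show ?thesis by simp
  qed
  have "(\<Sum>e\<in>S. p * (1 - p) * (influence p (insert a S) f e)\<^sup>2) \<le>
      (\<Sum>e\<in>S. p * (p * (1 - p) * (influence p S g e)\<^sup>2) + (1 - p) * (p * (1 - p) * (influence p S f e)\<^sup>2))"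
  proof (intro sum_mono)
    fix e assume "e \<in> S"
    have "p * (1 - p) * (influence p (insert a S) f e)\<^sup>2 \<le>
        p * (1 - p) * (p * (influence p S g e)\<^sup>2 + (1 - p) * (influence p S f e)\<^sup>2)"
      unfolding inf[OF \<open>e \<in> S\<close>] using assms by (intro mult_left_mono convex) auto
    then show "p * (1 - p) * (influence p (insert a S) f e)\<^sup>2 \<le>
        p * (p * (1 - p) * (influence p S g e)\<^sup>2) + (1 - p) * (p * (1 - p) * (influence p S f e)\<^sup>2)"
      by (simp add: algebra_simps)
  qed
  also have "\<dots> = p * (\<Sum>e\<in>S. p * (1 - p) * (influence p S g e)\<^sup>2) +
      (1 - p) * (\<Sum>e\<in>S. p * (1 - p) * (influence p S f e)\<^sup>2)"
    by (simp add: sum.distrib sum_distrib_left)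
  also have "\<dots> \<le> p * (Esub p S (\<lambda>F. (g F)\<^sup>2) - (Esub p S g)\<^sup>2) +
      (1 - p) * (Esub p S (\<lambda>F. (f F)\<^sup>2) - (Esub p S f)\<^sup>2)"
    using assms insert.IH by (intro add_mono mult_left_mono) auto
  finally have "(\<Sum>e\<in>insert a S. p * (1 - p) * (influence p (insert a S) f e)\<^sup>2) \<le>
      p * (1 - p) * (Esub p S g - Esub p S f)\<^sup>2 + (p * (Esub p S (\<lambda>F. (g F)\<^sup>2) - (Esub p S g)\<^sup>2) +
      (1 - p) * (Esub p S (\<lambda>F. (f F)\<^sup>2) - (Esub p S f)\<^sup>2))"
    using insert by (simp add: infa)
  \<comment> \<open>The law of total variance: the variance caused by the status of \<open>a\<close>
    plus the mean of the two conditional variances.\<close>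
  also have "\<dots> = Esub p (insert a S) (\<lambda>F. (f F)\<^sup>2) - (Esub p (insert a S) f)\<^sup>2"
    using insert by (simp add: Esub_insert g_def[symmetric] power2_eq_square) (simp add: algebra_simps)
  finally show ?case .
qed simp

text \<open>Given the status of \<open>e\<close>, the functions \<open>g\<close> and
  \<open>h\<close> depend on disjoint sets of elements and are independent. Hence only the status of
  \<open>e\<close> contributes to the covariance.\<close>

lemma covariance_shared_element:
  assumes "finite S" "T \<subseteq> S" "U \<subseteq> S" "T \<inter> U = {e}"
    and g: "\<And>F. F \<subseteq> S \<Longrightarrow> g F = g (F \<inter> T)" and h: "\<And>F. F \<subseteq> S \<Longrightarrow> h F = h (F \<inter> U)"
  shows "Esub p S (\<lambda>F. g F * h F) - Esub p S g * Esub p S h =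
    p * (1 - p) * (influence p S g e * influence p S h e)"
proof -
  define S' where "S' = S - {e}"
  have e: "e \<in> S" "e \<in> T" "e \<in> U" using assms by auto
  have S': "S = insert e S'" "finite S'" "e \<notin> S'" using assms e by (auto simp: S'_def)
  have sub: "T - {e} \<subseteq> S'" "U - {e} \<subseteq> S'" "(T - {e}) \<inter> (U - {e}) = {}"
    using assms by (auto simp: S'_def)
  have eq: "k (insert e F) = k (insert e (F \<inter> (X - {e})))" "k F = k (F \<inter> (X - {e}))"
    if k: "\<And>F. F \<subseteq> S \<Longrightarrow> k F = k (F \<inter> X)" and F: "F \<subseteq> S'" and X: "e \<in> X" for k :: "'a set \<Rightarrow> real" and F X
  proof -
    have "F \<inter> (X - {e}) = F \<inter> X" using F S'(3) by auto
    then show "k F = k (F \<inter> (X - {e}))" using k[of F] F S' by auto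
    have "k (insert e F) = k (insert e F \<inter> X)" using F S' by (intro k) auto
    also have "insert e F \<inter> X = insert e (F \<inter> (X - {e})) \<inter> X" using X by auto
    also have "k \<dots> = k (insert e (F \<inter> (X - {e})))"
      using F S' by (intro k[symmetric]) auto
    finally show "k (insert e F) = k (insert e (F \<inter> (X - {e})))" .
  qed
  have 1: "Esub p S' (\<lambda>F. g (insert e F) * h (insert e F)) =
      Esub p S' (\<lambda>F. g (insert e F)) * Esub p S' (\<lambda>F. h (insert e F))"
    by (rule Esub_indep[OF S'(2) sub]) (use eq(1)[where k=g and X=T, OF g _ e(2)] eq(1)[where k=h and X=U, OF h _ e(3)] in auto)
  have 2: "Esub p S' (\<lambda>F. g F * h F) = Esub p S' g * Esub p S' h"
    by (rule Esub_indep[OF S'(2) sub]) (use eq(2)[where k=g and X=T, OF g _ e(2)] eq(2)[where k=h and X=U, OF h _ e(3)] in auto)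
  have 3: "influence p S k e = Esub p S' (\<lambda>F. k (insert e F)) - Esub p S' k" for k
    unfolding S'_def using assms(1) e(1) by (rule influence_remove)
  show ?thesis
    unfolding 3 unfolding S'(1) Esub_insert[OF S'(2,3)] 1 2
    by (simp add: algebra_simps)
qed

text \<open>Two distinct vertices share one potential edge, so their covariance is a product of two
  influences. After splitting this product by the inequality of means, Bessel's inequality bounds
  all terms belonging to one vertex by its own variance, so each vertex accounts for at most twice
  \<open>1 / 4\<close>.\<close>

lemma variance_sum_vertices_le:
  fixes f :: "'a \<Rightarrow> 'a set set \<Rightarrow> real"
  assumes "finite V" "0 \<le> p" "p \<le> 1"
    and local: "\<And>v F. v \<in> V \<Longrightarrow> F \<subseteq> nsets V 2 \<Longrightarrow> f v F = f v {e \<in> F. v \<in> e}"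
    and bnd: "\<And>v F. v \<in> V \<Longrightarrow> F \<subseteq> nsets V 2 \<Longrightarrow> 0 \<le> f v F \<and> f v F \<le> 1"
  shows "Esub p (nsets V 2) (\<lambda>F. (\<Sum>v\<in>V. f v F)\<^sup>2) - (Esub p (nsets V 2) (\<lambda>F. \<Sum>v\<in>V. f v F))\<^sup>2
    \<le> card V / 2"
proof -
  define S where "S = nsets V 2"
  have fin: "finite S" unfolding S_def using assms(1) by (rule finite_imp_finite_nsets)
  define var where "var v = Esub p S (\<lambda>F. (f v F)\<^sup>2) - (Esub p S (f v))\<^sup>2" for v
  define cov where "cov u v = Esub p S (\<lambda>F. f u F * f v F) - Esub p S (f u) * Esub p S (f v)" for u v
  \<comment> \<open>An asymmetric share of the covariance, involving \<open>f u\<close> only; on the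
    diagonal it is the variance itself.\<close>
  define a where "a u v = (if v = u then var u else p * (1 - p) * (influence p S (f u) {u, v})\<^sup>2)" for u v
  have var: "var v \<le> 1 / 4" if "v \<in> V" for v
  proof -
    have "Esub p S (\<lambda>F. (f v F)\<^sup>2) \<le> Esub p S (f v)"
      using assms that by (intro Esub_mono) (auto simp: S_def power2_eq_square intro!: mult_left_le)
    \<comment> \<open>Since \<open>f v\<close> takes values in the unit interval, a mean x leaves
      variance at most x - x^2, hence at most 1/4.\<close>
    moreover have "(Esub p S (f v) - 1 / 2)\<^sup>2 \<ge> 0" by simp
    ultimately show ?thesis unfolding var_def by (simp add: power2_eq_square algebra_simps)
  qed
  have cov: "cov u v \<le> (a u v + a v u) / 2" if "u \<in> V" "v \<in> V" for u v
  proof (cases "u = v")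
    case True
    then show ?thesis by (simp add: cov_def a_def var_def power2_eq_square)
  next
    case False
    have e: "{u, v} \<in> S" using that False by (simp add: S_def nsets_def)
    have int: "{e \<in> S. u \<in> e} \<inter> {e \<in> S. v \<in> e} = {{u, v}}"
    proof
      show "{e \<in> S. u \<in> e} \<inter> {e \<in> S. v \<in> e} \<subseteq> {{u, v}}"
      proof
        fix e assume "e \<in> {e \<in> S. u \<in> e} \<inter> {e \<in> S. v \<in> e}"
        then have "{u, v} \<subseteq> e" "card e = 2" "finite e" by (auto simp: S_def nsets_def)
        then have "{u, v} = e" using False by (intro card_subset_eq) auto
        then show "e \<in> {{u, v}}" by simp
      qed
    qed (use e in auto)
    have loc: "f w F = f w (F \<inter> {e \<in> S. w \<in> e})" if "w \<in> V" "F \<subseteq> S" for w F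
    proof -
      have "F \<inter> {e \<in> S. w \<in> e} = {e \<in> F. w \<in> e}" using that by auto
      then show ?thesis using local[of w F] that by (simp add: S_def)
    qed
    have "cov u v = p * (1 - p) * (influence p S (f u) {u, v} * influence p S (f v) {u, v})"
      unfolding cov_def
      by (rule covariance_shared_element[OF fin _ _ int]) (use loc that in auto)
    also have "\<dots> \<le> p * (1 - p) * (((influence p S (f u) {u, v})\<^sup>2 + (influence p S (f v) {u, v})\<^sup>2) / 2)"
      using assms sum_squares_bound[of "influence p S (f u) {u, v}" "influence p S (f v) {u, v}"]
      by (intro mult_left_mono) auto
    also have "\<dots> = (a u v + a v u) / 2"
      using False False[symmetric] by (simp add: a_def insert_commute[of u v] algebra_simps)
    finally show ?thesis .
  qed
  have row: "(\<Sum>v\<in>V. a u v) \<le> 2 * var u" if "u \<in> V" for u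
  proof -
    have inj: "inj_on (\<lambda>v. {u, v}) (V - {u})" by (auto simp: inj_on_def doubleton_eq_iff)
    have "(\<Sum>v\<in>V. a u v) = var u + (\<Sum>v\<in>V - {u}. p * (1 - p) * (influence p S (f u) {u, v})\<^sup>2)"
      using that assms(1) by (subst sum.remove[of V u]) (auto simp: a_def)
    also have "(\<Sum>v\<in>V - {u}. p * (1 - p) * (influence p S (f u) {u, v})\<^sup>2) =
        (\<Sum>e\<in>(\<lambda>v. {u, v}) ` (V - {u}). p * (1 - p) * (influence p S (f u) e)\<^sup>2)"
      using inj by (simp add: sum.reindex)
    \<comment> \<open>The pairs containing \<open>u\<close> are some of the elements of
      \<open>S\<close>, so Bessel's inequality over all of \<open>S\<close> bounds the row.\<close>
    also have "\<dots> \<le> (\<Sum>e\<in>S. p * (1 - p) * (influence p S (f u) e)\<^sup>2)"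
      using fin that assms by (intro sum_mono2) (auto simp: S_def nsets_def)
    also have "\<dots> \<le> var u"
      unfolding var_def using fin assms(2,3) by (rule sum_influence_sq_le_variance)
    finally show ?thesis by simp
  qed
  have "Esub p S (\<lambda>F. (\<Sum>v\<in>V. f v F)\<^sup>2) - (Esub p S (\<lambda>F. \<Sum>v\<in>V. f v F))\<^sup>2 = (\<Sum>u\<in>V. \<Sum>v\<in>V. cov u v)"
    unfolding cov_def
    by (simp add: power2_eq_square sum_product Esub_sum sum_subtractf)
  also have "\<dots> \<le> (\<Sum>u\<in>V. \<Sum>v\<in>V. (a u v + a v u) / 2)"
    using cov by (intro sum_mono) auto
  also have "\<dots> = (\<Sum>u\<in>V. \<Sum>v\<in>V. a u v)"
  proof -
    have "(\<Sum>u\<in>V. \<Sum>v\<in>V. a v u) = (\<Sum>u\<in>V. \<Sum>v\<in>V. a u v)" by (rule sum.swap)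
    then show ?thesis by (simp add: sum_divide_distrib[symmetric] sum.distrib)
  qed
  also have "\<dots> \<le> (\<Sum>u\<in>V. 2 * (1 / 4))"
    using row var by (intro sum_mono) (force intro: order.trans)
  finally show ?thesis unfolding S_def by simp
qed

subsection \<open>The symmetric lazy walk and the bias of one vertex\<close>

text \<open>The expectation of \<open>g\<close> at the position after \<open>m\<close> steps of the walk on the integers, started at
  \<open>0\<close>, whose steps are \<open>1\<close> and \<open>-1\<close> with probability \<open>q\<close> each and \<open>0\<close> otherwise.\<close>

primrec walk :: "real \<Rightarrow> nat \<Rightarrow> (int \<Rightarrow> real) \<Rightarrow> real" where
  "walk q 0 g = g 0"
| "walk q (Suc m) g = q * walk q m (\<lambda>j. g (j - 1)) + (1 - 2 * q) * walk q m g + q * walk q m (\<lambda>j. g (j + 1))"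

lemma walk_add: "walk q m (\<lambda>j. g j + h j) = walk q m g + walk q m h"
  by (induction m arbitrary: g h) (simp_all add: algebra_simps)

lemma walk_cmult: "walk q m (\<lambda>j. c * g j) = c * walk q m g"
  by (induction m arbitrary: g) (simp_all add: algebra_simps)

lemma walk_diff: "walk q m (\<lambda>j. g j - h j) = walk q m g - walk q m h"
  using walk_add[of q m g "\<lambda>j. (- 1) * h j"] walk_cmult[of q m "- 1" h] by simp

lemma walk_const [simp]: "walk q m (\<lambda>_. c) = c"
  by (induction m) (simp_all add: algebra_simps)

lemma walk_sum: "finite I \<Longrightarrow> walk q m (\<lambda>j. \<Sum>i\<in>I. g i j) = (\<Sum>i\<in>I. walk q m (g i))"
  by (induction I rule: finite_induct) (simp_all add: walk_add)

lemma walk_mono: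
  assumes "0 \<le> q" "q \<le> 1 / 2" "\<And>j. g j \<le> h j"
  shows "walk q m g \<le> walk q m h"
  using assms(3)
proof (induction m arbitrary: g h)
  case (Suc m)
  then show ?case using assms(1,2) by (auto intro!: add_mono mult_left_mono)
qed simp

lemma walk_reflect: "walk q m (\<lambda>j. g (- j)) = walk q m g"
proof (induction m arbitrary: g)
  case (Suc m)
  have "walk q m (\<lambda>j. g (- (j - 1))) = walk q m (\<lambda>j. g (j + 1))"
    "walk q m (\<lambda>j. g (- (j + 1))) = walk q m (\<lambda>j. g (j - 1))"
    using Suc[of "\<lambda>j. g (j + 1)"] Suc[of "\<lambda>j. g (j - 1)"] by (simp_all add: algebra_simps)
  then show ?case using Suc[of g] by simp
qed simp

lemma walk_second_moment: "walk q m (\<lambda>j. (real_of_int j)\<^sup>2) = 2 * q * m"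
proof (induction m)
  case (Suc m)
  have "walk q m (\<lambda>j. (real_of_int (j - 1))\<^sup>2) + walk q m (\<lambda>j. (real_of_int (j + 1))\<^sup>2) =
      walk q m (\<lambda>j. 2 * (real_of_int j)\<^sup>2 + 2)"
    by (subst walk_add[symmetric], rule arg_cong[where f = "walk q m"])
      (simp add: fun_eq_iff power2_eq_square algebra_simps)
  also have "\<dots> = 2 * (2 * q * m) + 2"
    by (simp add: walk_add walk_cmult Suc)
  finally have "q * (walk q m (\<lambda>j. (real_of_int (j - 1))\<^sup>2) + walk q m (\<lambda>j. (real_of_int (j + 1))\<^sup>2)) =
      q * (2 * (2 * q * m) + 2)" by simp
  then show ?case using Suc by (simp add: algebra_simps)
qed simp

definition walk_pmf :: "real \<Rightarrow> nat \<Rightarrow> int \<Rightarrow> real" where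
  "walk_pmf q m j = walk q m (\<lambda>i. of_bool (i = j))"

lemma walk_pmf_Suc:
  "walk_pmf q (Suc m) j = q * walk_pmf q m (j + 1) + (1 - 2 * q) * walk_pmf q m j + q * walk_pmf q m (j - 1)"
proof -
  have "(\<lambda>i. of_bool (i - 1 = j) :: real) = (\<lambda>i. of_bool (i = j + 1))"
    "(\<lambda>i. of_bool (i + 1 = j) :: real) = (\<lambda>i. of_bool (i = j - 1))" by (auto simp: fun_eq_iff)
  then show ?thesis by (simp add: walk_pmf_def)
qed

lemma walk_pmf_minus: "walk_pmf q m (- j) = walk_pmf q m j"
proof -
  have "(\<lambda>i. of_bool (i = - j) :: real) = (\<lambda>i. of_bool (- i = j))" by (auto simp: fun_eq_iff)
  then show ?thesis unfolding walk_pmf_def using walk_reflect[of q m "\<lambda>i. of_bool (i = j)"] by simp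
qed

text \<open>A step preserves unimodality: each new difference of neighbouring masses is a
  nonnegative combination of old ones. At \<open>j = 0\<close> reflection merges two terms and
  leaves the coefficient \<open>1 - 3 * q\<close>.\<close>

lemma walk_pmf_antimono_step:
  assumes "0 \<le> q" "q \<le> 1 / 4" "0 \<le> j"
  shows "walk_pmf q m (j + 1) \<le> walk_pmf q m j"
  using assms(3)
proof (induction m arbitrary: j)
  case 0
  then show ?case by (simp add: walk_pmf_def)
next
  case (Suc m)
  let ?d = "walk_pmf q m"
  have up: "q * ?d (j + 2) \<le> q * ?d (j + 1)"
    using Suc.IH[of "j + 1"] Suc.prems assms by (intro mult_left_mono) (auto simp: add.commute)
  show ?case
  proof (cases "j = 0")
    case True
    have "(1 - 3 * q) * ?d 1 \<le> (1 - 3 * q) * ?d 0"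
      using Suc.IH[of 0] assms by (intro mult_left_mono) auto
    moreover have "?d (- 1) = ?d 1" by (rule walk_pmf_minus)
    ultimately show ?thesis using up True unfolding walk_pmf_Suc by (simp add: algebra_simps)
  next
    case False
    then have "?d j \<le> ?d (j - 1)" using Suc.IH[of "j - 1"] Suc.prems by simp
    then have "q * ?d j \<le> q * ?d (j - 1)" using assms by (intro mult_left_mono) auto
    moreover have "(1 - 2 * q) * ?d (j + 1) \<le> (1 - 2 * q) * ?d j"
      using Suc.IH[of j] Suc.prems assms by (intro mult_left_mono) auto
    ultimately show ?thesis using up unfolding walk_pmf_Suc by (simp add: algebra_simps)
  qed
qed

lemma walk_pmf_antimono:
  assumes "0 \<le> q" "q \<le> 1 / 4" "\<bar>i\<bar> \<le> \<bar>j\<bar>"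
  shows "walk_pmf q m j \<le> walk_pmf q m i"
proof -
  have abs: "walk_pmf q m k = walk_pmf q m \<bar>k\<bar>" for k
    using walk_pmf_minus[of q m k] by (simp add: abs_if)
  have "walk_pmf q m (\<bar>i\<bar> + int n) \<le> walk_pmf q m \<bar>i\<bar>" for n
  proof (induction n)
    case (Suc n)
    then show ?case using walk_pmf_antimono_step[of q "\<bar>i\<bar> + int n" m] assms
      by (simp add: algebra_simps)
  qed simp
  from this[of "nat (\<bar>j\<bar> - \<bar>i\<bar>)"] show ?thesis using assms abs[of i] abs[of j] by simp
qed

lemma walk_abs_le_eq_sum: "walk q m (\<lambda>j. of_bool (\<bar>j\<bar> \<le> int z)) = (\<Sum>j\<in>{- int z..int z}. walk_pmf q m j)"
proof -
  have "(\<lambda>i. of_bool (\<bar>i\<bar> \<le> int z) :: real) = (\<lambda>i. \<Sum>j\<in>{- int z..int z}. of_bool (i = j))"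
    by (auto simp: fun_eq_iff of_bool_def)
  then show ?thesis unfolding walk_pmf_def
    by (simp only: walk_sum finite_atLeastAtMost_int)
qed

text \<open>By unimodality the mean mass per site in the inner window is at least that in the outer
  one. The induction adds the sites at distance \<open>Suc M\<close>, each no heavier than any of
  the \<open>2 * z + 1\<close> inner sites.\<close>

lemma walk_abs_le_ratio:
  assumes "0 \<le> q" "q \<le> 1 / 4" "z \<le> M"
  shows "(2 * real z + 1) * walk q m (\<lambda>j. of_bool (\<bar>j\<bar> \<le> int M)) \<le>
    (2 * real M + 1) * walk q m (\<lambda>j. of_bool (\<bar>j\<bar> \<le> int z))"
  using assms(3)
proof (induction M rule: dec_induct)
  case (step M)
  let ?d = "walk_pmf q m" and ?Z = "\<Sum>j\<in>{- int z..int z}. walk_pmf q m j"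
  have "{- int (Suc M)..int (Suc M)} = insert (- int (Suc M)) (insert (int (Suc M)) {- int M..int M})"
    by auto
  then have split: "(\<Sum>j\<in>{- int (Suc M)..int (Suc M)}. ?d j) = 2 * ?d (int (Suc M)) + (\<Sum>j\<in>{- int M..int M}. ?d j)"
    using walk_pmf_minus[of q m "int (Suc M)"] by simp
  have "(\<Sum>j\<in>{- int z..int z}. ?d (int (Suc M))) \<le> ?Z"
    using step(1) by (intro sum_mono walk_pmf_antimono assms) auto
  then have "(2 * real z + 1) * ?d (int (Suc M)) \<le> ?Z" by (simp add: algebra_simps)
  then show ?case using step.IH unfolding walk_abs_le_eq_sum split by (simp add: algebra_simps)
qed simp

section \<open>From random neighbourhoods to the walk, and the resulting bias\<close>

text \<open>Pairing an element of \<open>A\<close> with one of \<open>B\<close> yields one step: it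
  is 1 or -1 when exactly one of the two is chosen, which has probability \<open>p * (1 - p)\<close>
  each way, and 0 otherwise.\<close>

lemma Esub_card_diff_eq_walk:
  assumes "finite A" "finite B" "A \<inter> B = {}" "card A = m" "card B = m"
  shows "Esub p (A \<union> B) (\<lambda>F. g (int (card (F \<inter> B)) - int (card (F \<inter> A)))) = walk (p * (1 - p)) m g"
  using assms
proof (induction m arbitrary: A B g)
  case 0
  then show ?case by simp
next
  case (Suc m)
  obtain a A' where A: "A = insert a A'" "a \<notin> A'" "card A' = m"
    using Suc.prems(4) by (auto simp: card_Suc_eq)
  obtain b B' where B: "B = insert b B'" "b \<notin> B'" "card B' = m"
    using Suc.prems(5) by (auto simp: card_Suc_eq)
  have fin: "finite A'" "finite B'" using Suc.prems A B by auto
  have ab: "a \<noteq> b" "a \<notin> B'" "b \<notin> A'" "A' \<inter> B' = {}" using Suc.prems A B by auto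
  let ?S = "A' \<union> B'"
  have IH: "Esub p ?S (\<lambda>F. h (int (card (F \<inter> B')) - int (card (F \<inter> A')))) = walk (p * (1 - p)) m h" for h
    using Suc.IH[of A' B' h] fin ab A B by simp
  have AB: "A \<union> B = insert a (insert b ?S)" using A B by auto
  have notin: "b \<notin> ?S" "a \<notin> insert b ?S" "finite ?S" "finite (insert b ?S)" using fin ab A B by auto
  define D where "D F = int (card (F \<inter> B)) - int (card (F \<inter> A))" for F
  define D' where "D' F = int (card (F \<inter> B')) - int (card (F \<inter> A'))" for F
  have D: "D F = D' F" "D (insert b F) = D' F + 1" "D (insert a F) = D' F - 1" "D (insert a (insert b F)) = D' F"
    if F: "F \<subseteq> ?S" for F
  proof -
    have fF: "finite (F \<inter> A')" "finite (F \<inter> B')" using fin by auto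
    have nF: "a \<notin> F" "b \<notin> F" using F ab A B by auto
    have 1: "F \<inter> A = F \<inter> A'" "F \<inter> B = F \<inter> B'"
      "insert b F \<inter> A = F \<inter> A'" "insert b F \<inter> B = insert b (F \<inter> B')"
      "insert a F \<inter> A = insert a (F \<inter> A')" "insert a F \<inter> B = F \<inter> B'"
      "insert a (insert b F) \<inter> A = insert a (F \<inter> A')" "insert a (insert b F) \<inter> B = insert b (F \<inter> B')"
      using A B ab nF by auto
    show "D F = D' F" "D (insert b F) = D' F + 1" "D (insert a F) = D' F - 1" "D (insert a (insert b F)) = D' F"
      unfolding D_def D'_def 1 using fF nF by simp_all
  qed
  have "Esub p (A \<union> B) (\<lambda>F. g (D F)) =
      p * (p * Esub p ?S (\<lambda>F. g (D (insert a (insert b F)))) + (1 - p) * Esub p ?S (\<lambda>F. g (D (insert a F)))) +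
      (1 - p) * (p * Esub p ?S (\<lambda>F. g (D (insert b F))) + (1 - p) * Esub p ?S (\<lambda>F. g (D F)))"
    unfolding AB using notin by (simp add: Esub_insert insert_commute)
  also have "\<dots> = p * (p * Esub p ?S (\<lambda>F. g (D' F)) + (1 - p) * Esub p ?S (\<lambda>F. g (D' F - 1))) +
      (1 - p) * (p * Esub p ?S (\<lambda>F. g (D' F + 1)) + (1 - p) * Esub p ?S (\<lambda>F. g (D' F)))"
    using D by (simp cong: Esub_cong)
  also have "\<dots> = walk (p * (1 - p)) (Suc m) g"
    unfolding D'_def IH[of g] IH[of "\<lambda>j. g (j - 1)"] IH[of "\<lambda>j. g (j + 1)"]
    by (simp add: algebra_simps)
  finally show ?case unfolding D_def .
qed

lemma Esub_card: "finite S \<Longrightarrow> Esub p S (\<lambda>F. real (card F)) = p * card S"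
proof (induction S rule: finite_induct)
  case (insert a S)
  have "Esub p S (\<lambda>F. real (card (insert a F))) = Esub p S (\<lambda>F. real (card F) + 1)"
    using insert by (intro Esub_cong) (auto simp: finite_subset card_insert_if)
  then show ?case using insert by (simp add: Esub_insert Esub_add algebra_simps)
qed simp

lemma Esub_card_sq: "finite S \<Longrightarrow> Esub p S (\<lambda>F. (real (card F))\<^sup>2) = p * (1 - p) * card S + (p * card S)\<^sup>2"
proof (induction S rule: finite_induct)
  case (insert a S)
  have "Esub p S (\<lambda>F. (real (card (insert a F)))\<^sup>2) = Esub p S (\<lambda>F. (real (card F))\<^sup>2 + 2 * real (card F) + 1)"
    using insert
    by (intro Esub_cong) (auto simp: finite_subset card_insert_if power2_eq_square algebra_simps)
  then have "Esub p S (\<lambda>F. (real (card (insert a F)))\<^sup>2) = Esub p S (\<lambda>F. (real (card F))\<^sup>2) + 2 * (p * card S) + 1"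
    using insert by (simp only: Esub_add Esub_cmult Esub_card Esub_const)
  then show ?case using insert
    by (simp add: Esub_insert power2_eq_square algebra_simps)
qed simp

text \<open>Replacing the truncation of \<open>z\<close> at \<open>M\<close> by the quadratic \<open>z - z\<^sup>2 / (4 M)\<close> leaves a bound whose
  expectation over a binomially distributed \<open>z\<close> needs only two moments.\<close>

lemma walk_abs_less_lower:
  assumes "0 \<le> q" "q \<le> 1 / 4" "2 * q * m \<le> L\<^sup>2" "3 * L\<^sup>2 \<le> (real M)\<^sup>2" "M > 0"
  shows "2 / 3 * ((2 * real z - (real z)\<^sup>2 / (2 * real M) - 1) / (2 * real M + 1)) \<le> walk q m (\<lambda>j. of_bool (\<bar>j\<bar> < int z))"
proof -
  let ?w = "walk q m (\<lambda>j. of_bool (\<bar>j\<bar> \<le> int M))"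
  \<comment> \<open>Chebyshev's inequality through the minorant 1 - j^2 / M^2; the second moment is
    at most a third of M^2, so the window of radius \<open>M\<close> has mass at least 2/3.\<close>
  have "walk q m (\<lambda>j. 1 - (1 / (real M)\<^sup>2) * (real_of_int j)\<^sup>2) \<le> ?w"
  proof (intro walk_mono)
    fix j :: int
    show "1 - (1 / (real M)\<^sup>2) * (real_of_int j)\<^sup>2 \<le> of_bool (\<bar>j\<bar> \<le> int M)"
    proof (cases "\<bar>j\<bar> \<le> int M")
      case False
      then have "(real M)\<^sup>2 \<le> (real_of_int j)\<^sup>2"
        by (intro abs_le_square_iff[THEN iffD1]) linarith
      then show ?thesis using assms False by (simp add: field_simps)
    qed simp
  qed (use assms in auto)
  moreover have "walk q m (\<lambda>j. 1 - (1 / (real M)\<^sup>2) * (real_of_int j)\<^sup>2) = 1 - (2 * q * m) / (real M)\<^sup>2"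
    by (simp only: walk_diff walk_cmult walk_const walk_second_moment) simp
  moreover have "(2 * q * m) / (real M)\<^sup>2 \<le> 1 / 3"
    using assms by (simp add: field_simps)
  ultimately have w: "2 / 3 \<le> ?w" by linarith
  show ?thesis
  proof (cases "z = 0")
    case True
    have "2 / 3 * ((2 * real z - (real z)\<^sup>2 / (2 * real M) - 1) / (2 * real M + 1)) \<le> 0"
      using True by (simp add: field_simps)
    also have "0 = walk q m (\<lambda>j. of_bool (\<bar>j\<bar> < int z))" using True by simp
    finally show ?thesis .
  next
    case False
    \<comment> \<open>The strict bound by \<open>z\<close> is the weak bound by \<open>y\<close>, so
      the window has \<open>2 * z - 1\<close> sites; this is the \<open>- 1\<close> in the
      statement.\<close>
    then obtain y where y: "z = Suc y" by (cases z) auto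
    have lt: "(\<lambda>j. of_bool (\<bar>j\<bar> < int z) :: real) = (\<lambda>j. of_bool (\<bar>j\<bar> \<le> int y))" by (auto simp: fun_eq_iff y)
    show ?thesis
    proof (cases "y \<le> M")
      case True
      have "2 * real z - (real z)\<^sup>2 / (2 * real M) - 1 \<le> 2 * real y + 1" by (simp add: y)
      then have "2 / 3 * ((2 * real z - (real z)\<^sup>2 / (2 * real M) - 1) / (2 * real M + 1)) \<le> 2 / 3 * ((2 * real y + 1) / (2 * real M + 1))"
        by (intro mult_left_mono divide_right_mono) auto
      also have "\<dots> \<le> ?w * ((2 * real y + 1) / (2 * real M + 1))"
        using w by (intro mult_right_mono) auto
      also have "\<dots> \<le> walk q m (\<lambda>j. of_bool (\<bar>j\<bar> \<le> int y))"
        using walk_abs_le_ratio[OF assms(1,2) True, of m] by (simp add: field_simps)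
      finally show ?thesis unfolding lt .
    next
      case False
      \<comment> \<open>Beyond the window the quadratic never exceeds its maximum
        \<open>2 * M\<close>, attained at \<open>z = 2 * M\<close>.\<close>
      have "0 \<le> (real z - 2 * real M)\<^sup>2" by simp
      then have "2 * real z - (real z)\<^sup>2 / (2 * real M) \<le> 2 * M"
        using assms(5) by (simp add: field_simps power2_eq_square)
      then have "2 / 3 * ((2 * real z - (real z)\<^sup>2 / (2 * real M) - 1) / (2 * real M + 1)) \<le> 2 / 3 * 1"
        by (intro mult_left_mono) (auto simp: field_simps)
      also have "\<dots> \<le> ?w" using w by simp
      also have "\<dots> \<le> walk q m (\<lambda>j. of_bool (\<bar>j\<bar> \<le> int y))"
        using False assms by (intro walk_mono) auto
      finally show ?thesis unfolding lt .
    qed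
  qed
qed

text \<open>Matching \<open>B\<close> with an equally large part \<open>A\<close> of
  \<open>R\<close> leaves a surplus \<open>C\<close> of \<open>k\<close> vertices. Red wins exactly
  when the walk of the matched pairs lies below the number of chosen vertices of \<open>C\<close>.
  By symmetry the bias is half the probability that the walk is within that random distance of 0,
  less a small correction for ties.\<close>

lemma majority_bias:
  fixes p L :: real and k :: nat
  assumes fin: "finite B" "finite R" and disj: "B \<inter> R = {}" and card: "card R = card B + k"
    and p: "0 \<le> p" "p \<le> 1" and L: "2 * (p * (1 - p)) * card B \<le> L\<^sup>2" "0 < L" and k: "19 \<le> p * k"
  shows "1 / 2 + 1 / 4 * min (p * k / (sqrt 3 * L)) (1 / 2) \<le>
    Esub p (B \<union> R) (\<lambda>F. of_bool (card (F \<inter> B) < card (F \<inter> R)))"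
proof -
  define m where "m = card B"
  define q where "q = p * (1 - p)"
  define \<mu> where "\<mu> = p * k"
  have "0 \<le> (p - 1 / 2)\<^sup>2" by simp
  then have q: "0 \<le> q" "q \<le> 1 / 4" using p mult_left_le[of p p]
    by (auto simp: q_def power2_eq_square algebra_simps)
  obtain A where A: "A \<subseteq> R" "card A = m" using card obtain_subset_with_card_n[of m R] by (auto simp: m_def)
  define C where "C = R - A"
  have finA: "finite A" "finite C" using A fin by (auto simp: C_def intro: finite_subset)
  have cardC: "card C = k" using A fin card by (simp add: C_def m_def card_Diff_subset finA)
  have dAB: "A \<inter> B = {}" "C \<inter> (A \<union> B) = {}" using A disj by (auto simp: C_def)
  define T where "T z = walk q m (\<lambda>j. of_bool (\<bar>j\<bar> < int z))" for z
  define d where "d = walk q m (\<lambda>j. of_bool (j = 0))"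
  \<comment> \<open>Adding the events \<open>j < z\<close> and \<open>- j < z\<close> counts every
    \<open>j\<close> once, and those with \<open>\<bar>j\<bar> < z\<close> twice; only
    \<open>j = 0\<close> with \<open>z = 0\<close> is missed.\<close>
  have half: "walk q m (\<lambda>j. of_bool (j < int z)) = 1 / 2 + (T z - d * of_bool (z = 0)) / 2" for z
  proof -
    have "2 * walk q m (\<lambda>j. of_bool (j < int z)) =
        walk q m (\<lambda>j. of_bool (j < int z) + of_bool (- j < int z))"
      using walk_reflect[of q m "\<lambda>j. of_bool (j < int z)"] by (simp add: walk_add)
    also have "\<dots> = walk q m (\<lambda>j. 1 + (of_bool (\<bar>j\<bar> < int z) - of_bool (z = 0) * of_bool (j = 0)))"
      by (rule arg_cong[where f = "walk q m"]) (auto simp: fun_eq_iff)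
    also have "\<dots> = 1 + (T z - of_bool (z = 0) * d)"
      unfolding T_def d_def by (simp only: walk_add walk_diff walk_cmult walk_const)
    finally have "2 * walk q m (\<lambda>j. of_bool (j < int z)) = 1 + (T z - d * of_bool (z = 0))"
      by (simp only: mult.commute)
    moreover have "w = 1 / 2 + t / 2" if "2 * w = 1 + t" for w t :: real using that by simp
    ultimately show ?thesis by blast
  qed
  have BR: "B \<union> R = C \<union> (A \<union> B)" using A by (auto simp: C_def)
  have "Esub p (B \<union> R) (\<lambda>F. of_bool (card (F \<inter> B) < card (F \<inter> R))) =
      Esub p C (\<lambda>G. Esub p (A \<union> B) (\<lambda>F. of_bool (card ((G \<union> F) \<inter> B) < card ((G \<union> F) \<inter> R))))"
    unfolding BR using finA fin dAB by (intro Esub_Un) auto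
  also have "\<dots> = Esub p C (\<lambda>G. Esub p (A \<union> B) (\<lambda>F. of_bool (int (card (F \<inter> B)) - int (card (F \<inter> A)) < int (card G))))"
  proof (intro Esub_cong)
    fix F G assume F: "F \<subseteq> A \<union> B" and G: "G \<subseteq> C"
    have "(G \<union> F) \<inter> B = F \<inter> B" "(G \<union> F) \<inter> R = G \<union> (F \<inter> A)"
      using F G dAB A disj by (auto simp: C_def)
    moreover have "card (G \<union> (F \<inter> A)) = card G + card (F \<inter> A)"
      using G finA dAB by (intro card_Un_disjoint) (auto intro: finite_subset)
    ultimately show "(of_bool (card ((G \<union> F) \<inter> B) < card ((G \<union> F) \<inter> R)) :: real) =
        of_bool (int (card (F \<inter> B)) - int (card (F \<inter> A)) < int (card G))" by auto
  qed
  also have "\<dots> = Esub p C (\<lambda>G. walk q m (\<lambda>j. of_bool (j < int (card G))))"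
    unfolding q_def using finA fin dAB A
    by (intro Esub_cong Esub_card_diff_eq_walk[where g = "\<lambda>j. of_bool (j < int (card _))"]) (auto simp: m_def)
  also have "\<dots> = Esub p C (\<lambda>G. 1 / 2 + (1 / 2) * (T (card G) - d * of_bool (card G = 0)))"
    by (simp add: half)
  also have "\<dots> = 1 / 2 + 1 / 2 * (Esub p C (\<lambda>G. T (card G)) - d * Esub p C (\<lambda>G. of_bool (card G = 0)))"
    using finA by (simp only: Esub_add Esub_cmult Esub_diff Esub_const)
  finally have eq: "Esub p (B \<union> R) (\<lambda>F. of_bool (card (F \<inter> B) < card (F \<inter> R))) =
      1 / 2 + 1 / 2 * (Esub p C (\<lambda>G. T (card G)) - d * Esub p C (\<lambda>G. of_bool (card G = 0)))" .
  define P0 where "P0 = Esub p C (\<lambda>G. of_bool (card G = 0))"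
  define ET where "ET = Esub p C (\<lambda>G. T (card G))"
  have mu: "19 \<le> \<mu>" using k by (simp add: \<mu>_def)
  \<comment> \<open>Chebyshev's inequality for the binomial surplus: it vanishes with probability at
    most \<open>1 / \<mu>\<close>.\<close>
  have "P0 \<le> Esub p C (\<lambda>G. 1 / \<mu>\<^sup>2 * ((real (card G))\<^sup>2 - 2 * \<mu> * real (card G) + \<mu>\<^sup>2))"
    unfolding P0_def
  proof (intro Esub_mono p)
    fix G
    have "0 \<le> 1 / \<mu>\<^sup>2 * (real (card G) - \<mu>)\<^sup>2" by simp
    then show "of_bool (card G = 0) \<le> 1 / \<mu>\<^sup>2 * ((real (card G))\<^sup>2 - 2 * \<mu> * real (card G) + \<mu>\<^sup>2)"
      using mu by (auto simp: power2_eq_square algebra_simps)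
  qed
  also have "\<dots> = 1 / \<mu>\<^sup>2 * ((1 - p) * \<mu>)"
    using finA
    by (simp only: Esub_add Esub_cmult Esub_diff Esub_const Esub_card_sq Esub_card cardC)
      (simp add: \<mu>_def power2_eq_square algebra_simps)
  also have "\<dots> \<le> 1 / \<mu>\<^sup>2 * (1 * \<mu>)"
    using p mu by (intro mult_left_mono mult_right_mono) auto
  also have "\<dots> = 1 / \<mu>" using mu by (simp add: power2_eq_square)
  also have "\<dots> \<le> 1 / 19" using mu by (intro divide_left_mono) auto
  finally have P0: "P0 \<le> 1 / 19" .
  \<comment> \<open>A nonzero surplus already captures the mass \<open>d\<close> at the origin. So
    \<open>ET\<close> is at least \<open>18 / 19 * d\<close>, and the tie correction
    \<open>d * P0\<close> is at most \<open>ET / 18\<close>.\<close>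
  have "Esub p C (\<lambda>G. d * (1 - of_bool (card G = 0))) \<le> ET"
    unfolding ET_def
  proof (intro Esub_mono p)
    fix G
    show "d * (1 - of_bool (card G = 0)) \<le> T (card G)"
    proof (cases "card G = 0")
      case False
      then show ?thesis using q unfolding d_def T_def by (auto intro!: walk_mono)
    qed (simp add: T_def)
  qed
  then have dle: "d * (1 - P0) \<le> ET"
    unfolding P0_def using finA by (simp only: Esub_cmult Esub_diff Esub_const)
  have d0: "0 \<le> d" unfolding d_def using walk_mono[of q "\<lambda>_. 0" _ m] q by simp
  have "d * (18 / 19) \<le> d * (1 - P0)" using P0 d0 by (intro mult_left_mono) auto
  moreover have "d * P0 \<le> d * (1 / 19)" using P0 d0 by (intro mult_left_mono) auto
  ultimately have ET1: "17 / 18 * ET \<le> ET - d * P0" using dle by linarith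
  \<comment> \<open>The bound \<open>sqrt 3 * L\<close> serves the Chebyshev estimate for the walk,
    and \<open>2 * \<mu>\<close> keeps the quadratic loss near \<open>\<mu> / 4\<close>. Rounding up
    to \<open>M\<close> adds at most 1.\<close>
  define X where "X = max (sqrt 3 * L) (2 * \<mu>)"
  define M where "M = nat \<lceil>X\<rceil>"
  have X: "2 * \<mu> \<le> X" "sqrt 3 * L \<le> X" "38 \<le> X" using mu by (auto simp: X_def)
  have M: "X \<le> M" "M \<le> X + 1" "M > 0" using X(3) unfolding M_def by linarith+
  have "(sqrt 3 * L)\<^sup>2 \<le> (real M)\<^sup>2" using X M L by (intro power_mono) auto
  then have M3: "3 * L\<^sup>2 \<le> (real M)\<^sup>2" by (simp add: power_mult_distrib)
  have T: "2 / 3 * ((2 * real z - (real z)\<^sup>2 / (2 * real M) - 1) / (2 * real M + 1)) \<le> T z" for z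
    unfolding T_def using L q M3 M by (intro walk_abs_less_lower) (auto simp: q_def m_def)
  have "Esub p C (\<lambda>G. 2 / (3 * (2 * real M + 1)) * (2 * real (card G) - 1 / (2 * real M) * (real (card G))\<^sup>2 - 1)) \<le> ET"
    unfolding ET_def
  proof (intro Esub_mono p)
    fix G
    show "2 / (3 * (2 * real M + 1)) * (2 * real (card G) - 1 / (2 * real M) * (real (card G))\<^sup>2 - 1) \<le> T (card G)"
      using T[of "card G"] by (simp add: mult.commute)
  qed
  then have ET2: "2 / (3 * (2 * real M + 1)) * (2 * \<mu> - 1 / (2 * real M) * (p * (1 - p) * k + \<mu>\<^sup>2) - 1) \<le> ET"
    using finA by (simp only: Esub_cmult Esub_diff Esub_const Esub_card_sq Esub_card cardC \<mu>_def)
  have "p * (1 - p) * k \<le> \<mu>" using p unfolding \<mu>_def by (simp add: mult_left_le mult_right_mono)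
  then have "1 / (2 * real M) * (p * (1 - p) * k + \<mu>\<^sup>2) \<le> 1 / (2 * real M) * (\<mu> + \<mu>\<^sup>2)"
    by (intro mult_left_mono) auto
  also have "\<dots> \<le> 1 / (4 * \<mu>) * (\<mu> + \<mu>\<^sup>2)"
    using X M mu by (intro mult_right_mono divide_left_mono) auto
  also have "\<dots> = (1 + \<mu>) / 4" using mu by (simp add: field_simps power2_eq_square)
  finally have le: "1 / (2 * real M) * (p * (1 - p) * k + \<mu>\<^sup>2) \<le> (1 + \<mu>) / 4" .
  have "7 / 4 * \<mu> - 5 / 4 \<le> 2 * \<mu> - t - 1" if "t \<le> (1 + \<mu>) / 4" for t
    using that by simp
  note sq = this[OF le]
  have "2 / (3 * (2 * X + 3)) * (7 / 4 * \<mu> - 5 / 4) \<le> 2 / (3 * (2 * real M + 1)) * (7 / 4 * \<mu> - 5 / 4)"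
    using X M mu by (intro mult_right_mono divide_left_mono) auto
  also have "\<dots> \<le> ET" using ET2 sq
    by (intro order.trans[OF mult_left_mono[OF sq] ET2]) auto
  finally have ET3: "2 / (3 * (2 * X + 3)) * (7 / 4 * \<mu> - 5 / 4) \<le> ET" .
  have "\<mu> / (2 * X) \<le> 17 / 18 * (2 / (3 * (2 * X + 3)) * (7 / 4 * \<mu> - 5 / 4))"
  proof -
    \<comment> \<open>Cleared of denominators, the claim is linear in \<open>X\<close>,
      \<open>\<mu>\<close> and their product; the lower bounds 19 and 38 make the product
      dominate.\<close>
    have "19 * X \<le> \<mu> * X" "38 * \<mu> \<le> X * \<mu>" using X mu by (intro mult_right_mono; simp)+
    then have "X * 340 + \<mu> * 648 \<le> X * (\<mu> * 44)" using X mu by (simp only: mult.commute[of \<mu> X])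
    then show ?thesis using X by (simp add: field_simps)
  qed
  also have "\<dots> \<le> 17 / 18 * ET" using ET3 by (intro mult_left_mono) auto
  also have "\<dots> \<le> ET - d * P0" by (rule ET1)
  finally have "\<mu> / (2 * X) \<le> ET - d * P0" .
  moreover have "min (\<mu> / (sqrt 3 * L)) (1 / 2) \<le> \<mu> / X"
    using mu L by (auto simp: X_def max_def min_le_iff_disj)
  ultimately show ?thesis unfolding eq P0_def[symmetric] ET_def[symmetric] \<mu>_def[symmetric] by (simp add: field_simps)
qed

subsection \<open>Exponential moments of weighted degrees\<close>

lemma bij_betw_neighbors_edges:
  assumes "F \<subseteq> nsets V 2"
  shows "bij_betw (\<lambda>u. {u, v}) (neighbors F v) {e \<in> F. v \<in> e}"
proof (rule bij_betwI')
  fix u w assume "u \<in> neighbors F v" "w \<in> neighbors F v"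
  then show "({u, v} = {w, v}) = (u = w)" by (auto simp: doubleton_eq_iff)
next
  fix u assume "u \<in> neighbors F v"
  then show "{u, v} \<in> {e \<in> F. v \<in> e}" by (auto simp: neighbors_def)
next
  fix e assume e: "e \<in> {e \<in> F. v \<in> e}"
  then have "card e = 2" using assms by (auto simp: nsets_def)
  then obtain a b where "e = {a, b}" by (auto simp: card_2_iff)
  then obtain u where "e = {u, v}" using e by auto
  then show "\<exists>u\<in>neighbors F v. e = {u, v}" using e by (auto simp: neighbors_def)
qed

lemma neighbors_neq: "F \<subseteq> nsets V 2 \<Longrightarrow> u \<in> neighbors F v \<Longrightarrow> u \<noteq> v \<and> u \<in> V \<and> v \<in> V"
  by (auto simp: neighbors_def nsets_def subset_iff)

lemma neighbors_nsets: "v \<in> V \<Longrightarrow> neighbors (nsets V 2) v = V - {v}"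
  by (auto simp: neighbors_def nsets_def)

lemma finite_neighbors: "finite V \<Longrightarrow> F \<subseteq> nsets V 2 \<Longrightarrow> finite (neighbors F v)"
  using neighbors_neq[of F V] by (auto intro: finite_subset[of _ V])

text \<open>Double counting of incidences. Summing over \<open>e - {v}\<close>, a singleton, names
  the other endpoint without a choice function.\<close>

lemma sum_edges_eq_sum_neighbors:
  fixes h :: "'a \<Rightarrow> 'a \<Rightarrow> real"
  assumes "finite V" "F \<subseteq> nsets V 2" "S \<subseteq> V"
  shows "(\<Sum>e\<in>F. \<Sum>v\<in>e \<inter> S. \<Sum>u\<in>e - {v}. h v u) = (\<Sum>v\<in>S. \<Sum>u\<in>neighbors F v. h v u)"
proof -
  have fin: "finite F" "finite S"
    using assms finite_imp_finite_nsets[of V 2] by (auto intro: finite_subset)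
  have "(\<Sum>u\<in>neighbors F v. h v u) = (\<Sum>e\<in>{e \<in> F. v \<in> e}. \<Sum>u\<in>e - {v}. h v u)" for v
  proof -
    have "(\<Sum>u\<in>neighbors F v. h v u) = (\<Sum>u\<in>neighbors F v. \<Sum>u'\<in>{u, v} - {v}. h v u')"
    proof (intro sum.cong refl)
      fix u assume "u \<in> neighbors F v"
      then have "{u, v} - {v} = {u}" using neighbors_neq[OF assms(2)] by auto
      then show "h v u = (\<Sum>u'\<in>{u, v} - {v}. h v u')" by simp
    qed
    also have "\<dots> = (\<Sum>e\<in>{e \<in> F. v \<in> e}. \<Sum>u\<in>e - {v}. h v u)"
      using bij_betw_neighbors_edges[OF assms(2)] by (rule sum.reindex_bij_betw)
    finally show ?thesis .
  qed
  then have "(\<Sum>v\<in>S. \<Sum>u\<in>neighbors F v. h v u) = (\<Sum>v\<in>S. \<Sum>e\<in>{e \<in> F. v \<in> e}. \<Sum>u\<in>e - {v}. h v u)"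
    by simp
  also have "\<dots> = (\<Sum>e\<in>F. \<Sum>v\<in>{v \<in> S. v \<in> e}. \<Sum>u\<in>e - {v}. h v u)"
    using fin by (intro sum.swap_restrict) auto
  also have "\<dots> = (\<Sum>e\<in>F. \<Sum>v\<in>e \<inter> S. \<Sum>u\<in>e - {v}. h v u)"
    by (intro sum.cong) auto
  finally show ?thesis by simp
qed

text \<open>If both endpoints lie in \<open>S\<close>, the inequality of means separates their
  contributions; if only one does, the same inequality is used with the other exponent 0.\<close>

lemma exp_edge_weight_le:
  fixes x :: "'a \<Rightarrow> real"
  assumes "e \<in> nsets V 2"
  shows "exp (\<Sum>v\<in>e \<inter> S. \<Sum>u\<in>e - {v}. x u) - 1 \<le> (\<Sum>v\<in>e \<inter> S. \<Sum>u\<in>e - {v}. (exp (2 * x u) - 1) / 2)"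
proof -
  obtain a b where e: "e = {a, b}" "a \<noteq> b" using assms by (auto simp: nsets_def card_2_iff)
  have am: "exp (s + t) \<le> (exp (2 * s) + exp (2 * t)) / 2" for s t :: real
    using sum_squares_bound[of "exp s" "exp t"]
    by (simp add: exp_add power2_eq_square exp_double)
  have am1: "exp s - 1 \<le> (exp (2 * s) - 1) / 2" for s :: real
    using am[of s 0] by simp
  have ab: "{a, b} - {a} = {b}" "{a, b} - {b} = {a}" using e by auto
  consider "a \<in> S" "b \<in> S" | "a \<in> S" "b \<notin> S" | "a \<notin> S" "b \<in> S" | "a \<notin> S" "b \<notin> S" by blast
  then show ?thesis
  proof cases
    case 1
    then have "e \<inter> S = {a, b}" using e by auto
    then show ?thesis using e am[of "x b" "x a"] by (simp add: ab field_simps)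
  next
    case 2
    then have "e \<inter> S = {a}" using e by auto
    then show ?thesis using e am1[of "x b"] by (simp add: ab)
  next
    case 3
    then have "e \<inter> S = {b}" using e by auto
    then show ?thesis using e am1[of "x a"] by (simp add: ab)
  next
    case 4
    then have "e \<inter> S = {}" using e by auto
    then show ?thesis by simp
  qed
qed

text \<open>An edge inside \<open>S\<close> is counted from both endpoints; decoupling these two contributions by
  \<open>2 exp (s + t) \<le> exp (2 s) + exp (2 t)\<close> costs the factor \<open>2\<close> in the exponent.\<close>

lemma Esub_exp_neighbors_le:
  fixes x :: "'a \<Rightarrow> real"
  assumes "finite V" "S \<subseteq> V" "0 \<le> p" "p \<le> 1"
  shows "Esub p (nsets V 2) (\<lambda>F. exp (\<Sum>v\<in>S. \<Sum>u\<in>neighbors F v. x u)) \<le>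
    exp (p / 2 * (\<Sum>v\<in>S. \<Sum>u\<in>V - {v}. exp (2 * x u) - 1))"
proof -
  let ?E = "nsets V 2"
  define w where "w e = (\<Sum>v\<in>e \<inter> S. \<Sum>u\<in>e - {v}. x u)" for e
  have "Esub p ?E (\<lambda>F. exp (\<Sum>v\<in>S. \<Sum>u\<in>neighbors F v. x u)) = Esub p ?E (\<lambda>F. exp (\<Sum>e\<in>F. w e))"
    unfolding w_def using assms(1,2) by (intro Esub_cong) (simp add: sum_edges_eq_sum_neighbors[where h = "\<lambda>_. x"])
  also have "\<dots> \<le> exp (p * (\<Sum>e\<in>?E. exp (w e) - 1))"
    using assms finite_imp_finite_nsets by (intro Esub_exp_sum_le) auto
  also have "(\<Sum>e\<in>?E. exp (w e) - 1) \<le> (\<Sum>e\<in>?E. \<Sum>v\<in>e \<inter> S. \<Sum>u\<in>e - {v}. (exp (2 * x u) - 1) / 2)"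
    unfolding w_def by (intro sum_mono exp_edge_weight_le)
  also have "\<dots> = (\<Sum>v\<in>S. \<Sum>u\<in>neighbors ?E v. (exp (2 * x u) - 1) / 2)"
    using assms(1,2) by (intro sum_edges_eq_sum_neighbors) auto
  also have "\<dots> = (\<Sum>v\<in>S. \<Sum>u\<in>V - {v}. (exp (2 * x u) - 1) / 2)"
    using assms(2) by (intro sum.cong) (auto simp: neighbors_nsets)
  also have "\<dots> = 1 / 2 * (\<Sum>v\<in>S. \<Sum>u\<in>V - {v}. exp (2 * x u) - 1)"
    by (simp add: sum_distrib_left sum_divide_distrib)
  finally show ?thesis using assms by (simp add: mult_left_mono)
qed

section \<open>Tail bounds for fixed vertex sets\<close>

text \<open>Second-order Taylor expansion: the linear terms cancel, and on this range the
  exponential in the remainder is at most \<open>11 / 10\<close>.\<close>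

lemma exp_plus_exp_minus_le:
  assumes "0 \<le> y" "y \<le> (9 / 100 :: real)"
  shows "exp y + exp (- y) - 2 \<le> 11 / 10 * y\<^sup>2"
proof -
  have 1: "exp z \<le> 1 + z + 11 / 20 * y\<^sup>2" if "\<bar>z\<bar> = y" for z
  proof -
    obtain t where t: "\<bar>t\<bar> \<le> \<bar>z\<bar>" "exp z = (\<Sum>m<2. z ^ m / fact m) + exp t / fact 2 * z ^ 2"
      using Maclaurin_exp_le[of z 2] by blast
    have "exp t \<le> exp y" using t(1) that by simp
    also have "\<dots> \<le> 1 + y + y\<^sup>2" using assms by (intro exp_bound) auto
    also have "\<dots> \<le> 1 + 9 / 100 + (9 / 100)\<^sup>2" using assms by (intro add_mono power_mono) auto
    also have "\<dots> \<le> 11 / 10" by (simp add: power2_eq_square)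
    finally have "exp t / 2 * z\<^sup>2 \<le> 11 / 20 * z\<^sup>2" by (intro mult_right_mono) auto
    moreover have "z\<^sup>2 = y\<^sup>2" using that by (metis power2_abs)
    moreover have "exp z = 1 + z + exp t / 2 * z\<^sup>2" using t(2) by (simp add: numeral_2_eq_2)
    ultimately show ?thesis by linarith
  qed
  show ?thesis using 1[of y] 1[of "- y"] assms by simp
qed

lemma exp_minus_exp_ge:
  assumes "0 \<le> (y :: real)"
  shows "2 * y \<le> exp y - exp (- y)"
proof -
  define f where "f y = exp y - exp (- y) - 2 * y" for y :: real
  have "f 0 \<le> f y"
  proof (rule DERIV_nonneg_imp_nondecreasing[OF assms])
    fix x :: real
    have "(f has_real_derivative (exp x + exp (- x) - 2)) (at x)"
      unfolding f_def by (auto intro!: derivative_eq_intros)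
    moreover have "exp x * exp (- x) = 1" by (simp add: exp_minus)
    then have "0 \<le> exp x + exp (- x) - 2"
      using arith_geo_mean_sqrt[of "exp x" "exp (- x)"] by simp
    ultimately show "\<exists>y. (f has_real_derivative y) (at x) \<and> 0 \<le> y" by blast
  qed
  then show ?thesis by (simp add: f_def)
qed

text \<open>A Chernoff bound with weight \<open>- s\<close> on Red and \<open>s\<close> on the other
  vertices: a weak Blue majority at every vertex of \<open>S\<close> makes the total weight
  nonnegative. The surplus \<open>D\<close> gives the linear gain, and the summand
  \<open>1 / 2\<close> pays for a vertex not being its own neighbour.\<close>

lemma prob_blue_majority_on:
  assumes V: "finite V" "card V = n" and R: "R \<subseteq> V" "real n / 2 + D \<le> real (card R)"
    and S: "S \<subseteq> V" "card S = m" and p: "0 \<le> p" "p \<le> 1" and s: "0 \<le> s" "s \<le> 9 / 200" and D: "0 \<le> D"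
  shows "Esub p (nsets V 2) (\<lambda>F. of_bool (\<forall>v\<in>S. card (neighbors F v \<inter> R) \<le> card (neighbors F v - R)))
    \<le> exp (p * m * (11 / 10 * s\<^sup>2 * n - 2 * D * s + 1 / 2))"
proof -
  define x where "x u = (if u \<in> R then - s else s)" for u
  define y where "y = 2 * s"
  have fin: "finite R" using V R by (auto intro: finite_subset)
  have "Esub p (nsets V 2) (\<lambda>F. of_bool (\<forall>v\<in>S. card (neighbors F v \<inter> R) \<le> card (neighbors F v - R)))
    \<le> Esub p (nsets V 2) (\<lambda>F. exp (\<Sum>v\<in>S. \<Sum>u\<in>neighbors F v. x u))"
  proof (rule Esub_markov[OF p])
    fix F assume F: "F \<subseteq> nsets V 2" and H: "\<forall>v\<in>S. card (neighbors F v \<inter> R) \<le> card (neighbors F v - R)"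
    have "0 \<le> (\<Sum>u\<in>neighbors F v. x u)" if "v \<in> S" for v
    proof -
      have "(\<Sum>u\<in>neighbors F v. x u) = (\<Sum>u\<in>neighbors F v \<inter> R. - s) + (\<Sum>u\<in>neighbors F v - R. s)"
        using finite_neighbors[OF V(1) F]
        by (subst sum.Int_Diff[where B = R]) (auto simp: x_def intro!: arg_cong2[where f = "(+)"] sum.cong)
      also have "\<dots> = s * (real (card (neighbors F v - R)) - real (card (neighbors F v \<inter> R)))"
        by (simp add: algebra_simps)
      also have "\<dots> \<ge> 0" using H that s by simp
      finally show ?thesis .
    qed
    then have "0 \<le> (\<Sum>v\<in>S. \<Sum>u\<in>neighbors F v. x u)" by (rule sum_nonneg)
    then show "1 \<le> exp (\<Sum>v\<in>S. \<Sum>u\<in>neighbors F v. x u)" by simp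
  qed simp
  also have "\<dots> \<le> exp (p / 2 * (\<Sum>v\<in>S. \<Sum>u\<in>V - {v}. exp (2 * x u) - 1))"
    using V S p by (intro Esub_exp_neighbors_le) auto
  also have "\<dots> \<le> exp (p * m * (11 / 10 * s\<^sup>2 * n - 2 * D * s + 1 / 2))"
  proof -
    have "(\<Sum>u\<in>V - {v}. exp (2 * x u) - 1) \<le> 22 / 10 * s\<^sup>2 * n - 4 * D * s + 1" if "v \<in> S" for v
    proof -
      have "(\<Sum>u\<in>V. exp (2 * x u) - 1) = (\<Sum>u\<in>V \<inter> R. exp (- y) - 1) + (\<Sum>u\<in>V - R. exp y - 1)"
        using V by (subst sum.Int_Diff[where B = R]) (auto simp: x_def y_def intro!: arg_cong2[where f = "(+)"] sum.cong)
      also have "\<dots> = card R * (exp (- y) - 1) + (real n - card R) * (exp y - 1)"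
        using V R fin card_mono[of V R] by (simp add: Int_absorb1 card_Diff_subset of_nat_diff)
      also have "\<dots> = n / 2 * (exp y + exp (- y) - 2) - (card R - n / 2) * (exp y - exp (- y))"
        by (simp add: field_simps)
      also have "\<dots> \<le> n / 2 * (11 / 10 * y\<^sup>2) - D * (2 * y)"
      proof (intro diff_mono mult_left_mono)
        show "exp y + exp (- y) - 2 \<le> 11 / 10 * y\<^sup>2"
          using s by (intro exp_plus_exp_minus_le) (auto simp: y_def)
        have sinh: "2 * y \<le> exp y - exp (- y)" "0 \<le> 2 * y" using s exp_minus_exp_ge[of y] by (auto simp: y_def)
        show "D * (2 * y) \<le> (card R - n / 2) * (exp y - exp (- y))"
          using R sinh D by (intro mult_mono) auto
      qed auto
      finally have "(\<Sum>u\<in>V. exp (2 * x u) - 1) \<le> n / 2 * (11 / 10 * y\<^sup>2) - D * (2 * y)" .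
      moreover have "(\<Sum>u\<in>V - {v}. exp (2 * x u) - 1) = (\<Sum>u\<in>V. exp (2 * x u) - 1) - (exp (2 * x v) - 1)"
        using V S that by (subst sum_diff1) auto
      moreover have "0 \<le> exp (2 * x v)" by simp
      ultimately have "(\<Sum>u\<in>V - {v}. exp (2 * x u) - 1) \<le> n / 2 * (11 / 10 * y\<^sup>2) - D * (2 * y) + 1" by linarith
      then show ?thesis by (simp add: y_def power2_eq_square algebra_simps)
    qed
    then have "(\<Sum>v\<in>S. \<Sum>u\<in>V - {v}. exp (2 * x u) - 1) \<le> (\<Sum>v\<in>S. 22 / 10 * s\<^sup>2 * n - 4 * D * s + 1)"
      by (rule sum_mono)
    then have "p / 2 * (\<Sum>v\<in>S. \<Sum>u\<in>V - {v}. exp (2 * x u) - 1) \<le> p / 2 * (m * (22 / 10 * s\<^sup>2 * n - 4 * D * s + 1))"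
      using p S by (intro mult_left_mono) auto
    then show ?thesis by (simp add: algebra_simps)
  qed
  finally show ?thesis .
qed

text \<open>Lower-tail Chernoff bound. Only the edges at \<open>v\<close> carry weight, each counted
  once, so no decoupling factor appears.\<close>

lemma prob_degree_le:
  assumes V: "finite V" "card V = n" "v \<in> V" and p: "0 \<le> p" "p \<le> 1" and t: "0 \<le> t"
  shows "Esub p (nsets V 2) (\<lambda>F. of_bool (real (card (neighbors F v)) \<le> c))
    \<le> exp (t * c + p * (real n - 1) * (exp (- t) - 1))"
proof -
  let ?E = "nsets V 2"
  define w where "w e = (if v \<in> e then - t else 0)" for e
  have fin: "finite ?E" using V finite_imp_finite_nsets by auto
  have deg: "(\<Sum>e\<in>F. if v \<in> e then c else 0) = card (neighbors F v) * c" if "F \<subseteq> ?E" for F and c :: real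
  proof -
    have "card (neighbors F v) = card {e \<in> F. v \<in> e}"
      by (rule bij_betw_same_card[OF bij_betw_neighbors_edges[OF that]])
    moreover have "finite F" using that fin by (rule finite_subset)
    ultimately show ?thesis by (simp add: sum.If_cases Int_def)
  qed
  have "Esub p ?E (\<lambda>F. of_bool (real (card (neighbors F v)) \<le> c)) \<le> Esub p ?E (\<lambda>F. exp (t * c) * exp (\<Sum>e\<in>F. w e))"
  proof (rule Esub_markov[OF p])
    fix F assume F: "F \<subseteq> ?E" and le: "real (card (neighbors F v)) \<le> c"
    have "(\<Sum>e\<in>F. w e) = - t * card (neighbors F v)" using deg[OF F, of "- t"] by (simp add: w_def)
    also have "\<dots> \<ge> - t * c" using le t by (simp add: mult_left_mono)
    finally show "1 \<le> exp (t * c) * exp (\<Sum>e\<in>F. w e)" by (simp add: exp_add[symmetric])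
  qed simp
  also have "\<dots> \<le> exp (t * c) * exp (p * (\<Sum>e\<in>?E. exp (w e) - 1))"
    unfolding Esub_cmult using p fin by (intro mult_left_mono Esub_exp_sum_le) auto
  also have "(\<Sum>e\<in>?E. exp (w e) - 1) = (\<Sum>e\<in>?E. if v \<in> e then exp (- t) - 1 else 0)"
    by (intro sum.cong) (auto simp: w_def)
  also have "\<dots> = card (V - {v}) * (exp (- t) - 1)"
    using deg[of ?E "exp (- t) - 1"] V by (simp add: neighbors_nsets)
  also have "real (card (V - {v})) = real n - 1"
    using V card_gt_0_iff[of V] by (auto simp: card_Diff_singleton of_nat_diff)
  finally show ?thesis by (simp add: exp_add mult.assoc)
qed

text \<open>Upper-tail Chernoff bound, jointly for all of \<open>S\<close>;
  \<open>exp (2 * t)\<close> in place of \<open>exp t\<close> is the price of decoupling edges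
  inside \<open>S\<close>.\<close>

lemma prob_many_neighbors_in:
  assumes V: "finite V" and B: "B \<subseteq> V" and S: "S \<subseteq> V" and p: "0 \<le> p" "p \<le> 1" and t: "0 \<le> t"
  shows "Esub p (nsets V 2) (\<lambda>F. of_bool (\<forall>v\<in>S. c \<le> real (card (neighbors F v \<inter> B))))
    \<le> exp (card S * (p / 2 * card B * exp (2 * t) - t * c))"
proof -
  define x where "x u = (if u \<in> B then t else 0)" for u
  have fin: "finite B" using V B by (auto intro: finite_subset)
  have "Esub p (nsets V 2) (\<lambda>F. of_bool (\<forall>v\<in>S. c \<le> real (card (neighbors F v \<inter> B))))
    \<le> Esub p (nsets V 2) (\<lambda>F. exp (- (card S * (t * c))) * exp (\<Sum>v\<in>S. \<Sum>u\<in>neighbors F v. x u))"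
  proof (rule Esub_markov[OF p])
    fix F assume F: "F \<subseteq> nsets V 2" and H: "\<forall>v\<in>S. c \<le> real (card (neighbors F v \<inter> B))"
    have "t * c \<le> (\<Sum>u\<in>neighbors F v. x u)" if "v \<in> S" for v
    proof -
      have "(\<Sum>u\<in>neighbors F v. x u) = t * card (neighbors F v \<inter> B)"
        unfolding x_def using finite_neighbors[OF V(1) F] by (simp add: sum.If_cases)
      then show ?thesis using H that t by (simp add: mult_left_mono)
    qed
    then have "(\<Sum>v\<in>S. t * c) \<le> (\<Sum>v\<in>S. \<Sum>u\<in>neighbors F v. x u)" by (rule sum_mono)
    then show "1 \<le> exp (- (card S * (t * c))) * exp (\<Sum>v\<in>S. \<Sum>u\<in>neighbors F v. x u)"
      by (simp add: exp_add[symmetric])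
  qed simp
  also have "\<dots> \<le> exp (- (card S * (t * c))) * exp (p / 2 * (\<Sum>v\<in>S. \<Sum>u\<in>V - {v}. exp (2 * x u) - 1))"
    unfolding Esub_cmult using V S p by (intro mult_left_mono Esub_exp_neighbors_le) auto
  also have "\<dots> \<le> exp (- (card S * (t * c))) * exp (p / 2 * (\<Sum>v\<in>S. card B * exp (2 * t)))"
  proof -
    have "(\<Sum>u\<in>V - {v}. exp (2 * x u) - 1) \<le> card B * exp (2 * t)" for v
    proof -
      have "(\<Sum>u\<in>V - {v}. exp (2 * x u) - 1) \<le> (\<Sum>u\<in>V. exp (2 * x u) - 1)"
        using V t by (intro sum_mono2) (auto simp: x_def)
      also have "\<dots> = (\<Sum>u\<in>V. if u \<in> B then exp (2 * t) - 1 else 0)"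
        by (intro sum.cong) (auto simp: x_def)
      also have "\<dots> = card B * (exp (2 * t) - 1)"
        using V B by (simp add: sum.If_cases Int_absorb1)
      also have "\<dots> \<le> card B * exp (2 * t)" by (intro mult_left_mono) auto
      finally show ?thesis .
    qed
    then show ?thesis using p by (intro mult_left_mono iffD2[OF exp_le_cancel_iff] sum_mono) auto
  qed
  finally show ?thesis by (simp add: exp_add[symmetric] algebra_simps)
qed

subsection \<open>The first day\<close>

lemma neighbors_image_edges:
  assumes "G \<subseteq> V - {v}"
  shows "neighbors ((\<lambda>u. {u, v}) ` G) v = G"
  using assms by (auto simp: neighbors_def doubleton_eq_iff)

text \<open>Edges away from \<open>v\<close> average out, and each remaining edge is renamed to its
  other endpoint.\<close>

lemma Esub_neighbors:
  assumes "finite V" "v \<in> V"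
  shows "Esub p (nsets V 2) (\<lambda>F. g (neighbors F v)) = Esub p (V - {v}) g"
proof -
  let ?T = "(\<lambda>u. {u, v}) ` (V - {v})"
  have "Esub p (nsets V 2) (\<lambda>F. g (neighbors F v)) = Esub p ?T (\<lambda>F. g (neighbors F v))"
  proof (rule Esub_marginal)
    fix F assume F: "F \<subseteq> nsets V 2"
    have "neighbors F v = neighbors (F \<inter> ?T) v"
      using neighbors_neq[OF F] by (auto simp: neighbors_def)
    then show "g (neighbors F v) = g (neighbors (F \<inter> ?T) v)" by simp
  qed (use assms finite_imp_finite_nsets in \<open>auto simp: nsets_def\<close>)
  also have "\<dots> = Esub p (V - {v}) (\<lambda>G. g (neighbors ((\<lambda>u. {u, v}) ` G) v))"
    using assms by (intro Esub_image) (auto simp: inj_on_def doubleton_eq_iff)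
  also have "\<dots> = Esub p (V - {v}) g"
    by (intro Esub_cong) (simp add: neighbors_image_edges)
  finally show ?thesis .
qed

text \<open>The inequality is weak because a tie leaves a Blue vertex Blue.\<close>

lemma not_majority_step_RedD:
  assumes "majority_step F c v \<noteq> Red"
  shows "card {u \<in> neighbors F v. c u = Red} \<le> card {u \<in> neighbors F v. c u \<noteq> Red}"
proof -
  have "c u \<noteq> Red \<longleftrightarrow> c u = Blue" for u by (cases "c u") auto
  then show ?thesis using assms by (auto simp: majority_step_def Let_def split: if_splits)
qed

text \<open>Applies the bias estimate to the neighbourhood of \<open>v\<close>, with
  \<open>v\<close> removed from its own class; a strict Red majority there forces Red whatever the
  color of \<open>v\<close>.\<close>

lemma prob_first_step_red:
  assumes V: "finite V" "R \<union> B = V" "R \<inter> B = {}" and card: "real (card R) = real (card V) / 2 + \<Delta>"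
    and p: "0 < p" "p \<le> 1" and \<Delta>: "10 \<le> p * \<Delta>" and v: "v \<in> V"
    and L: "L = sqrt (p * card V)"
  shows "1 / 2 + 1 / 4 * min (p * (2 * \<Delta> - 1) / (sqrt 3 * L)) (1 / 2) \<le>
    Esub p (nsets V 2) (\<lambda>F. of_bool (majority_step F (initial_coloring R) v = Red))"
proof -
  define R' where "R' = R - {v}"
  define B' where "B' = B - {v}"
  define k where "k = card R' - card B'"
  have fin: "finite R" "finite B" "finite R'" "finite B'" using V by (auto simp: R'_def B'_def)
  have disj: "B' \<inter> R' = {}" and BR: "V - {v} = B' \<union> R'" using V by (auto simp: R'_def B'_def)
  have cV: "real (card V) = real (card R) + real (card B)"
    using V fin card_Un_disjoint[of R B] by auto
  have cB: "real (card B) = real (card V) / 2 - \<Delta>" using cV card by simp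
  have pD: "p * \<Delta> \<le> 1 * \<Delta>" if "0 \<le> \<Delta>" using p that by (intro mult_right_mono) auto
  have D10: "10 \<le> \<Delta>"
  proof -
    have "0 \<le> \<Delta>"
      using p \<Delta> by (meson less_le_trans not_le zero_less_mult_pos zero_less_numeral le_less)
    then show ?thesis using pD \<Delta> by simp
  qed
  have R1: "real (card R) - 1 \<le> real (card R')" "real (card B') \<le> real (card B)"
    unfolding R'_def B'_def using fin card_Diff1_le[of B v] by (auto simp: card_Diff_singleton_if)
  \<comment> \<open>Deleting \<open>v\<close> costs Red at most one vertex, whence the
    \<open>- 1\<close>. As \<open>p \<le> 1\<close>, this lowers the bound 20 on
    \<open>2 * p * \<Delta>\<close> to no less than 19.\<close>
  have R2: "2 * \<Delta> - 1 \<le> real (card R') - real (card B')"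
    using R1 cB card by linarith
  then have k: "card R' = card B' + k" "2 * \<Delta> - 1 \<le> real k" using D10 by (auto simp: k_def of_nat_diff)
  have pk: "p * (2 * \<Delta> - 1) \<le> p * k" using k p by (intro mult_left_mono) auto
  have pk19: "19 \<le> p * (2 * \<Delta> - 1)" using \<Delta> p by (simp add: algebra_simps)
  have n0: "0 < real (card V)" using V v card_gt_0_iff by auto
  have L0: "0 < L" using p n0 by (simp add: L)
  have "2 * (p * (1 - p)) * card B' = p * ((1 - p) * (2 * card B'))" by simp
  also have "\<dots> \<le> p * (1 * real (card V))"
  proof (rule mult_left_mono)
    show "(1 - p) * (2 * card B') \<le> 1 * real (card V)"
      using p R1 cB D10 by (intro mult_mono) auto
  qed (use p in auto)
  also have "\<dots> = L\<^sup>2" using p n0 by (simp add: L)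
  finally have L2: "2 * (p * (1 - p)) * card B' \<le> L\<^sup>2" .
  have "1 / 2 + 1 / 4 * min (p * (2 * \<Delta> - 1) / (sqrt 3 * L)) (1 / 2) \<le>
      1 / 2 + 1 / 4 * min (p * k / (sqrt 3 * L)) (1 / 2)"
    using k(2) p L0 by (intro add_left_mono mult_left_mono min.mono divide_right_mono) auto
  also have "\<dots> \<le> Esub p (V - {v}) (\<lambda>G. of_bool (card (G \<inter> B') < card (G \<inter> R')))"
    unfolding BR using fin disj k(1) p L2 L0 order.trans[OF pk19 pk] by (intro majority_bias) auto
  also have "\<dots> = Esub p (nsets V 2) (\<lambda>F. of_bool (card (neighbors F v \<inter> B') < card (neighbors F v \<inter> R')))"
    using Esub_neighbors[OF V(1) v, of p "\<lambda>G. of_bool (card (G \<inter> B') < card (G \<inter> R'))"] by simp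
  also have "\<dots> \<le> Esub p (nsets V 2) (\<lambda>F. of_bool (majority_step F (initial_coloring R) v = Red))"
  proof (intro Esub_mono)
    fix F assume F: "F \<subseteq> nsets V 2"
    have N: "neighbors F v \<subseteq> V - {v}" using neighbors_neq[OF F, of _ v] by auto
    have "{u \<in> neighbors F v. initial_coloring R u = Red} = neighbors F v \<inter> R'"
      using N by (auto simp: initial_coloring_def R'_def)
    moreover have "{u \<in> neighbors F v. initial_coloring R u \<noteq> Red} = neighbors F v \<inter> B'"
      using N V by (auto simp: initial_coloring_def B'_def)
    ultimately show "(of_bool (card (neighbors F v \<inter> B') < card (neighbors F v \<inter> R')) :: real)
        \<le> of_bool (majority_step F (initial_coloring R) v = Red)"
      using not_majority_step_RedD[of F "initial_coloring R" v]
      by (cases "majority_step F (initial_coloring R) v = Red") auto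
  qed (use p in auto)
  finally show ?thesis .
qed

text \<open>Chebyshev's inequality: the mean exceeds n/2 by at least \<open>n * \<gamma>\<close>,
  the required excess \<open>2 * n / L\<close> is at most three quarters of that, and the variance
  is at most n/2.\<close>

lemma prob_few_red_after_first_step:
  fixes V :: "'a set"
  assumes V: "finite V" "R \<union> B = V" "R \<inter> B = {}" and n: "card V = n" and card: "real (card R) = real n / 2 + \<Delta>"
    and p: "0 < p" "p \<le> 1" and \<Delta>: "10 \<le> p * \<Delta>" and L: "L = sqrt (p * n)" "22 \<le> L"
  shows "Esub p (nsets V 2) (\<lambda>F. of_bool (card {v \<in> V. majority_step F (initial_coloring R) v = Red} < real n / 2 + 2 * real n / L))
    \<le> 512 / min n (p * \<Delta>\<^sup>2)"
proof -
  let ?E = "nsets V 2"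
  define \<gamma> where "\<gamma> = 1 / 4 * min (p * (2 * \<Delta> - 1) / (sqrt 3 * L)) (1 / 2)"
  define f :: "'a \<Rightarrow> 'a set set \<Rightarrow> real"
    where "f v F = of_bool (majority_step F (initial_coloring R) v = Red)" for v F
  define N where "N F = (\<Sum>v\<in>V. f v F)" for F
  define \<mu> where "\<mu> = Esub p ?E N"
  define a where "a = real n / 2 + 2 * real n / L"
  have finE: "finite ?E" using V(1) by (rule finite_imp_finite_nsets)
  have n0: "0 < real n" using L by (cases "n = 0") auto
  have NF: "real (card {v \<in> V. majority_step F (initial_coloring R) v = Red}) = N F" for F
    using V(1) by (simp add: N_def f_def Int_def)
  have "(\<Sum>v\<in>V. 1 / 2 + \<gamma>) \<le> (\<Sum>v\<in>V. Esub p ?E (f v))"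
    unfolding \<gamma>_def f_def using assms by (intro sum_mono prob_first_step_red) auto
  then have mean: "n / 2 + n * \<gamma> \<le> \<mu>"
    unfolding \<mu>_def N_def using n by (simp add: Esub_sum algebra_simps)
  have var: "Esub p ?E (\<lambda>F. (N F)\<^sup>2) - \<mu>\<^sup>2 \<le> n / 2"
    unfolding \<mu>_def N_def n[symmetric]
  proof (rule variance_sum_vertices_le)
    fix v F assume "v \<in> V" "F \<subseteq> ?E"
    have "neighbors {e \<in> F. v \<in> e} v = neighbors F v" by (auto simp: neighbors_def)
    then show "f v F = f v {e \<in> F. v \<in> e}" by (simp add: f_def majority_step_def)
  qed (use V p in \<open>auto simp: f_def\<close>)
  have L0: "0 < L" using L(2) by linarith
  have s3: "sqrt 3 * 8 \<le> 57 / 4"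
    by (rule power2_le_imp_le) (simp_all add: power_mult_distrib power2_eq_square)
  have D0: "0 < \<Delta>" using p \<Delta> by (smt (verit) mult_nonneg_nonpos)
  have pk19: "19 \<le> p * (2 * \<Delta> - 1)" using \<Delta> p by (simp add: algebra_simps)
  \<comment> \<open>The first branch of the minimum uses \<open>32 / 3 * sqrt 3 \<le> 19\<close>,
    the second uses \<open>L \<ge> 22\<close>.\<close>
  have "8 / 3 / L \<le> \<gamma>"
  proof -
    have "32 / 3 / L = (32 / 3 * sqrt 3) / (sqrt 3 * L)" using L0 by simp
    also have "\<dots> \<le> p * (2 * \<Delta> - 1) / (sqrt 3 * L)"
      using s3 pk19 L0 by (intro divide_right_mono) auto
    finally have "32 / 3 / L \<le> p * (2 * \<Delta> - 1) / (sqrt 3 * L)" .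
    moreover have "32 / 3 / L \<le> 1 / 2" using L(2) by (simp add: field_simps)
    ultimately have "32 / 3 / L \<le> min (p * (2 * \<Delta> - 1) / (sqrt 3 * L)) (1 / 2)" by simp
    then show ?thesis unfolding \<gamma>_def by simp
  qed
  then have "n * (8 / 3 / L) \<le> n * \<gamma>" by (intro mult_left_mono) auto
  moreover have "2 * real n / L = 3 / 4 * (n * (8 / 3 / L))" using L0 by (simp add: field_simps)
  ultimately have gap: "n * \<gamma> / 4 \<le> \<mu> - a" using mean unfolding a_def by linarith
  have g0: "0 < \<gamma>" using \<open>8 / 3 / L \<le> \<gamma>\<close> L0 by (smt (verit) divide_pos_pos)
  have gap0: "0 < \<mu> - a" using gap g0 n0 by (smt (verit) divide_pos_pos mult_pos_pos)
  have "Esub p ?E (\<lambda>F. of_bool (N F < a)) \<le> Esub p ?E (\<lambda>F. 1 / (\<mu> - a)\<^sup>2 * ((N F)\<^sup>2 - 2 * \<mu> * N F + \<mu>\<^sup>2))"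
  proof (rule Esub_markov)
    fix F
    have eq: "(N F)\<^sup>2 - 2 * \<mu> * N F + \<mu>\<^sup>2 = (\<mu> - N F)\<^sup>2" by (simp add: power2_eq_square algebra_simps)
    show "0 \<le> 1 / (\<mu> - a)\<^sup>2 * ((N F)\<^sup>2 - 2 * \<mu> * N F + \<mu>\<^sup>2)" unfolding eq by simp
    assume "N F < a"
    then have "(\<mu> - a)\<^sup>2 \<le> (\<mu> - N F)\<^sup>2" using gap0 by (intro power_mono) auto
    then show "1 \<le> 1 / (\<mu> - a)\<^sup>2 * ((N F)\<^sup>2 - 2 * \<mu> * N F + \<mu>\<^sup>2)" unfolding eq using gap0 by (simp add: field_simps)
  qed (use p in auto)
  also have "\<dots> = 1 / (\<mu> - a)\<^sup>2 * (Esub p ?E (\<lambda>F. (N F)\<^sup>2) - \<mu>\<^sup>2)"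
    using finE by (simp only: Esub_cmult Esub_add Esub_diff Esub_const \<mu>_def[symmetric])
      (simp add: power2_eq_square)
  also have "\<dots> \<le> 1 / (\<mu> - a)\<^sup>2 * (n / 2)" using var by (intro mult_left_mono) auto
  also have "\<dots> \<le> 1 / (n * \<gamma> / 4)\<^sup>2 * (n / 2)"
    using gap g0 n0 gap0 by (intro mult_right_mono divide_left_mono power_mono mult_pos_pos) auto
  also have "\<dots> = 8 / (n * \<gamma>\<^sup>2)" using n0 by (simp add: power2_eq_square field_simps)
  also have "\<dots> \<le> 8 / (min n (p * \<Delta>\<^sup>2) / 64)"
  proof (rule divide_left_mono)
    define w where "w = min (p * (2 * \<Delta> - 1) / (sqrt 3 * L)) (1 / 2)"
    \<comment> \<open>In the first branch n cancels against \<open>L\<^sup>2 = p * n\<close> and a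
      multiple of \<open>p * \<Delta>\<^sup>2\<close> remains; in the second
      \<open>w = 1 / 2\<close> gives n/4. With the factor 1/16 from \<open>\<gamma>\<close> this
      yields 8 * 64 = 512.\<close>
    have "min n (p * \<Delta>\<^sup>2) / 4 \<le> n * w\<^sup>2"
    proof (cases "p * (2 * \<Delta> - 1) / (sqrt 3 * L) \<le> 1 / 2")
      case True
      have Dp: "19 / 10 * (p * \<Delta>) \<le> p * (2 * \<Delta> - 1)" using \<Delta> p by (simp add: algebra_simps)
      have L2: "L\<^sup>2 = p * n" using p L by simp
      have "n * w\<^sup>2 = n * ((p * (2 * \<Delta> - 1))\<^sup>2 / (3 * L\<^sup>2))"
        using True by (simp add: w_def power_divide power_mult_distrib)
      also have "\<dots> = (p * (2 * \<Delta> - 1))\<^sup>2 / (3 * p)" using n0 p by (simp add: L2)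
      also have "\<dots> \<ge> (19 / 10 * (p * \<Delta>))\<^sup>2 / (3 * p)"
        using Dp \<Delta> p by (intro divide_right_mono power_mono) auto
      also have "(19 / 10 * (p * \<Delta>))\<^sup>2 / (3 * p) = 361 / 300 * (p * \<Delta>\<^sup>2)"
        using p by (simp add: power2_eq_square field_simps)
      finally have "361 / 300 * (p * \<Delta>\<^sup>2) \<le> n * w\<^sup>2" .
      moreover have "0 \<le> p * \<Delta>\<^sup>2" using p by simp
      ultimately show ?thesis by (auto simp: min_def)
    next
      case False
      then have w2: "w\<^sup>2 = 1 / 4" by (simp add: w_def power2_eq_square)
      show ?thesis unfolding w2 by simp
    qed
    moreover have "n * \<gamma>\<^sup>2 = n * w\<^sup>2 / 16" unfolding \<gamma>_def w_def by (simp add: power2_eq_square)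
    ultimately show "min n (p * \<Delta>\<^sup>2) / 64 \<le> n * \<gamma>\<^sup>2" by linarith
    show "0 < n * \<gamma>\<^sup>2 * (min n (p * \<Delta>\<^sup>2) / 64)"
      using n0 g0 p D0 by (intro mult_pos_pos divide_pos_pos) auto
  qed simp
  finally show ?thesis unfolding NF a_def by simp
qed

section \<open>Union bounds over vertex sets and vertices\<close>

text \<open>There are at most \<open>4 ^ n \<le> exp (7 n / 5)\<close> pairs \<open>(R, S)\<close>; \<open>s = D / n\<close> is the optimal exponent up
  to constants.\<close>

lemma prob_exists_blue_majority_on:
  assumes V: "finite V" "card V = n" and p: "0 \<le> p" "p \<le> 1" and D: "0 \<le> D" "D \<le> 9 / 200 * n"
  shows "Esub p (nsets V 2) (\<lambda>F. of_bool (\<exists>R S. R \<subseteq> V \<and> S \<subseteq> V \<and> real n / 2 + D \<le> real (card R) \<and> card S = m \<and>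
      (\<forall>v\<in>S. card (neighbors F v \<inter> R) \<le> card (neighbors F v - R))))
    \<le> exp (7 / 5 * n + p * m * (1 / 2 - 9 / 10 * D\<^sup>2 / n))"
proof (cases "n = 0")
  case True
  then have "V = {}" using V by simp
  then show ?thesis using True D by (auto simp: nsets_def)
next
  case False
  define I where "I = {(R, S). R \<subseteq> V \<and> S \<subseteq> V \<and> real n / 2 + D \<le> real (card R) \<and> card S = m}"
  define s where "s = D / n"
  have IP: "I \<subseteq> Pow V \<times> Pow V" by (auto simp: I_def)
  then have finI: "finite I" using V by (auto intro: finite_subset)
  have "card I \<le> card (Pow V \<times> Pow V)" using IP V by (intro card_mono) auto
  also have "\<dots> = (2 * 2) ^ n" using V by (simp only: card_cartesian_product card_Pow power_mult_distrib)
  finally have "real (card I) \<le> real ((2 * 2) ^ n)" by (rule of_nat_mono)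
  also have "\<dots> = 4 ^ n" by simp
  also have "\<dots> \<le> exp (7 / 5) ^ n"
  proof (rule power_mono)
    \<comment> \<open>A rational proof that exp (7/5) is at least 4: the quadratic Taylor bound at
      1/10, raised to the power 14.\<close>
    have "(4::real) \<le> (221 / 200) ^ 14" by (simp add: power_divide)
    also have "(221 / 200 :: real) = 1 + 1 / 10 + (1 / 10)\<^sup>2 / 2" by (simp add: power2_eq_square)
    also have "(1 + 1 / 10 + (1 / 10)\<^sup>2 / 2) ^ 14 \<le> exp (1 / 10 :: real) ^ 14" by (intro power_mono exp_lower_Taylor_quadratic) auto
    also have "\<dots> = exp (7 / 5)" by (simp add: exp_of_nat_mult[symmetric])
    finally show "(4::real) \<le> exp (7 / 5)" .
  qed simp
  also have "\<dots> = exp (7 / 5 * n)" by (simp add: exp_of_nat_mult[symmetric] mult.commute)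
  finally have cI: "real (card I) \<le> exp (7 / 5 * n)" .
  have "Esub p (nsets V 2) (\<lambda>F. of_bool (\<exists>R S. R \<subseteq> V \<and> S \<subseteq> V \<and> real n / 2 + D \<le> real (card R) \<and> card S = m \<and>
      (\<forall>v\<in>S. card (neighbors F v \<inter> R) \<le> card (neighbors F v - R)))) =
    Esub p (nsets V 2) (\<lambda>F. of_bool (\<exists>i\<in>I. \<forall>v\<in>snd i. card (neighbors F v \<inter> fst i) \<le> card (neighbors F v - fst i)))"
    by (intro Esub_cong arg_cong[where f = of_bool]) (auto simp: I_def)
  also have "\<dots> \<le> real (card I) * exp (p * m * (11 / 10 * s\<^sup>2 * n - 2 * D * s + 1 / 2))"
  proof (rule Esub_union_bound[OF p finI])
    fix i assume "i \<in> I"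
    then show "Esub p (nsets V 2) (\<lambda>F. of_bool (\<forall>v\<in>snd i. card (neighbors F v \<inter> fst i) \<le> card (neighbors F v - fst i)))
        \<le> exp (p * m * (11 / 10 * s\<^sup>2 * n - 2 * D * s + 1 / 2))"
      using V p D False by (intro prob_blue_majority_on) (auto simp: I_def s_def field_simps)
  qed
  also have "11 / 10 * s\<^sup>2 * n - 2 * D * s + 1 / 2 = 1 / 2 - 9 / 10 * D\<^sup>2 / n"
    using False by (simp add: s_def power2_eq_square field_simps)
  also have "real (card I) * exp (p * m * (1 / 2 - 9 / 10 * D\<^sup>2 / n)) \<le>
      exp (7 / 5 * n) * exp (p * m * (1 / 2 - 9 / 10 * D\<^sup>2 / n))"
    using cI by (intro mult_right_mono) auto
  finally show ?thesis by (simp add: exp_add)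
qed

text \<open>The condition on \<open>\<delta>\<close> bounds the Chernoff exponent per unit of mean
  degree. The factor \<open>exp 1\<close> absorbs the difference between n - 1 and n potential
  neighbours.\<close>

lemma prob_exists_low_degree:
  assumes V: "finite V" "card V = n" and p: "0 \<le> p" "p \<le> 1" and t: "0 \<le> t" and n: "0 < n"
    and \<delta>: "t * \<epsilon> + exp (- t) \<le> \<delta>"
  shows "Esub p (nsets V 2) (\<lambda>F. of_bool (\<exists>v\<in>V. real (card (neighbors F v)) \<le> \<epsilon> * (p * n)))
    \<le> exp 1 * (n * exp (- ((1 - \<delta>) * (p * n))))"
proof -
  have "Esub p (nsets V 2) (\<lambda>F. of_bool (\<exists>v\<in>V. real (card (neighbors F v)) \<le> \<epsilon> * (p * n)))
    \<le> card V * exp (t * (\<epsilon> * (p * n)) + p * (real n - 1) * (exp (- t) - 1))"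
    using V p t by (intro Esub_union_bound prob_degree_le) auto
  also have "\<dots> \<le> n * exp (1 - (1 - \<delta>) * (p * n))"
  proof -
    have "t * (\<epsilon> * (p * n)) + p * (real n - 1) * (exp (- t) - 1) =
        (p * n) * (t * \<epsilon> + exp (- t) - 1) + p * (1 - exp (- t))"
      by (simp add: algebra_simps)
    also have "\<dots> \<le> (p * n) * (\<delta> - 1) + 1 * 1"
      using p t \<delta> by (intro add_mono mult_left_mono mult_mono) auto
    finally show ?thesis using V by (intro mult_mono) (auto simp: algebra_simps)
  qed
  also have "\<dots> = exp 1 * (n * exp (- ((1 - \<delta>) * (p * n))))"
    by (simp only: diff_conv_add_uminus exp_add) simp
  finally show ?thesis .
qed

subsection \<open>The later days\<close>

text \<open>Rests on b^b / b! being a single term of the series of exp b.\<close>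

lemma binomial_le_exp:
  assumes "1 \<le> b" "b \<le> n"
  shows "real (n choose b) \<le> exp (b * (1 + ln (n / b)))"
proof -
  have "real b ^ b / fact b \<le> exp b"
  proof -
    have "(\<Sum>k\<in>{b}. real b ^ k /\<^sub>R fact k) \<le> (\<Sum>k. real b ^ k /\<^sub>R fact k)"
      using summable_exp_generic[of "real b"] by (intro sum_le_suminf) auto
    then show ?thesis by (simp add: exp_def field_simps)
  qed
  then have fb: "real b ^ b \<le> exp b * fact b" by (simp add: field_simps)
  have "real (n choose b) * real b ^ b \<le> real (n choose b) * (exp b * fact b)"
    using fb by (intro mult_left_mono) auto
  also have "\<dots> = exp b * real ((n choose b) * fact b)" by simp
  also have "\<dots> \<le> exp b * real (n ^ b)"
    using binomial_fact_pow[of n b] by (intro mult_left_mono) (simp_all del: of_nat_mult of_nat_power)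
  finally have "real (n choose b) \<le> exp b * (real n ^ b / real b ^ b)"
    using assms by (simp add: field_simps)
  also have "real n ^ b / real b ^ b = exp (b * ln (n / b))"
    using assms by (simp add: exp_of_nat_mult power_divide)
  finally show ?thesis by (simp add: exp_add[symmetric] algebra_simps)
qed

text \<open>With the tilt \<open>exp (2 t) = \<surd>(n / b)\<close> a single pair \<open>(B, S)\<close> fails with probability at most
  \<open>exp (- 6 b ln (n / b))\<close>, which beats the number \<open>exp (4 b ln (n / b))\<close> of pairs.\<close>

lemma prob_exists_shrink_failure:
  assumes V: "finite V" "card V = n" and p: "0 \<le> p" "p \<le> 1" and b: "1 \<le> b" and n: "0 < n"
    and \<epsilon>: "0 < \<epsilon>" and r: "r = sqrt (p * n)" "96 / \<epsilon> \<le> r" "1 \<le> r"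
    and l: "2 * ln (8 / \<epsilon>) \<le> ln (n / b)" "1 \<le> ln (n / b)" and m: "m = nat \<lceil>b / r\<rceil>"
  shows "Esub p (nsets V 2) (\<lambda>F. of_bool (\<exists>B S. B \<subseteq> V \<and> S \<subseteq> V \<and> card B = b \<and> card S = m \<and>
      (\<forall>v\<in>S. \<epsilon> * (p * n) / 2 \<le> real (card (neighbors F v \<inter> B))))) \<le> 1 / (real n)\<^sup>2"
proof -
  define l where "l = ln (n / b)"
  define I where "I = {B. B \<subseteq> V \<and> card B = b} \<times> {S. S \<subseteq> V \<and> card S = m}"
  have l1: "1 \<le> l" "2 * ln (8 / \<epsilon>) \<le> l" using l by (auto simp: l_def)
  have nb: "real n = b * exp l" using b n by (simp add: l_def)
  have "2 \<le> exp (1::real)" using exp_ge_add_one_self[of 1] by simp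
  also have "\<dots> \<le> exp l" using l1 by simp
  finally have "real b * 2 \<le> real b * exp l" by (intro mult_left_mono) auto
  then have bn: "real b * 2 \<le> n" using nb by simp
  have r2: "r\<^sup>2 = p * n" using p r by simp
  have mb: "b / r \<le> m" unfolding m using r by simp
  have "m \<le> b"
  proof -
    have "b / r \<le> b" using r by (simp add: field_simps mult_le_cancel_left1)
    then show ?thesis unfolding m by (simp add: ceiling_le_iff nat_le_iff)
  qed
  then have "n choose m \<le> n choose b"
    using bn by (intro binomial_mono) auto
  then have "real (n choose b) * real (n choose m) \<le> exp (b * (1 + l)) * exp (b * (1 + l))"
    using binomial_le_exp[OF b, of n] bn unfolding l_def by (intro mult_mono) auto
  also have "\<dots> = exp (2 * b * (1 + l))" by (simp add: exp_add[symmetric])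
  also have "2 * b * (1 + l) \<le> 2 * b * (2 * l)" using l1 by (intro mult_left_mono) auto
  finally have count: "real (n choose b) * real (n choose m) \<le> exp (4 * (b * l))" by simp
  have cI: "real (card I) = real (n choose b) * real (n choose m)"
    using V by (simp add: I_def card_cartesian_product n_subsets)
  have finI: "finite I" using V by (auto simp: I_def)
  have "Esub p (nsets V 2) (\<lambda>F. of_bool (\<exists>B S. B \<subseteq> V \<and> S \<subseteq> V \<and> card B = b \<and> card S = m \<and>
      (\<forall>v\<in>S. \<epsilon> * (p * n) / 2 \<le> real (card (neighbors F v \<inter> B))))) =
    Esub p (nsets V 2) (\<lambda>F. of_bool (\<exists>i\<in>I. \<forall>v\<in>snd i. \<epsilon> * (p * n) / 2 \<le> real (card (neighbors F v \<inter> fst i))))"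
    by (intro Esub_cong arg_cong[where f = of_bool]) (auto simp: I_def)
  also have "\<dots> \<le> real (card I) * exp (- (6 * (b * l)))"
  proof (rule Esub_union_bound[OF p finI])
    fix i assume i: "i \<in> I"
    have "Esub p (nsets V 2) (\<lambda>F. of_bool (\<forall>v\<in>snd i. \<epsilon> * (p * n) / 2 \<le> real (card (neighbors F v \<inter> fst i))))
      \<le> exp (card (snd i) * (p / 2 * card (fst i) * exp (2 * (l / 4)) - l / 4 * (\<epsilon> * (p * n) / 2)))"
      using i V p l1 by (intro prob_many_neighbors_in) (auto simp: I_def)
    also have "\<dots> = exp (m * (p / 2 * b * exp (l / 2) - l / 4 * (\<epsilon> * (p * n) / 2)))"
      using i by (simp add: I_def mem_Times_iff)
    also have "\<dots> \<le> exp (- (6 * (b * l)))"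
    proof -
      \<comment> \<open>The lower bound on \<open>l\<close> makes the mean term at most half of the
        gain from the tilt. The other half, over at least \<open>b / r\<close> vertices with
        \<open>r * \<epsilon> \<ge> 96\<close>, amounts to \<open>6 * b * l\<close>.\<close>
      have "exp (- (l / 2)) \<le> exp (- ln (8 / \<epsilon>))" using l1 by simp
      also have "\<dots> = \<epsilon> / 8" using \<epsilon> by (simp add: exp_minus field_simps)
      also have "\<dots> \<le> \<epsilon> / 8 * l" using l1 \<epsilon> by simp
      finally have "p * n / 2 * exp (- (l / 2)) \<le> p * n / 2 * (\<epsilon> / 8 * l)"
        using p by (intro mult_left_mono) auto
      moreover have "p / 2 * b * exp (l / 2) = p * n / 2 * exp (- (l / 2))"
      proof -
        have "exp l * exp (- (l / 2)) = exp (l / 2)" by (simp add: exp_add[symmetric])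
        then show ?thesis unfolding nb by (simp add: mult.assoc)
      qed
      moreover have "p * n / 2 * (\<epsilon> / 8 * l) - l / 4 * (\<epsilon> * (p * n) / 2) = - (r\<^sup>2 * \<epsilon> * l / 16)"
        unfolding r2 by simp
      ultimately have "p / 2 * b * exp (l / 2) - l / 4 * (\<epsilon> * (p * n) / 2) \<le> - (r\<^sup>2 * \<epsilon> * l / 16)"
        by linarith
      then have "m * (p / 2 * b * exp (l / 2) - l / 4 * (\<epsilon> * (p * n) / 2)) \<le> m * (- (r\<^sup>2 * \<epsilon> * l / 16))"
        by (intro mult_left_mono) auto
      moreover have "b / r * (r\<^sup>2 * \<epsilon> * l / 16) \<le> m * (r\<^sup>2 * \<epsilon> * l / 16)"
        using mb \<epsilon> l1 by (intro mult_right_mono) auto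
      moreover have "b / r * (r\<^sup>2 * \<epsilon> * l / 16) = b * l * (r * \<epsilon>) / 16"
        using r(3) by (simp add: power2_eq_square)
      moreover have "b * l * 96 \<le> b * l * (r * \<epsilon>)"
        using r(2) \<epsilon> l1 by (intro mult_left_mono) (auto simp: field_simps)
      ultimately have "m * (p / 2 * b * exp (l / 2) - l / 4 * (\<epsilon> * (p * n) / 2)) \<le> - (6 * (b * l))"
        by simp
      then show ?thesis by simp
    qed
    finally show "Esub p (nsets V 2) (\<lambda>F. of_bool (\<forall>v\<in>snd i. \<epsilon> * (p * n) / 2 \<le> real (card (neighbors F v \<inter> fst i))))
      \<le> exp (- (6 * (b * l)))" .
  qed
  also have "\<dots> \<le> exp (4 * (b * l)) * exp (- (6 * (b * l)))"
    unfolding cI using count by (intro mult_right_mono) auto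
  also have "\<dots> = exp (- (2 * (b * l)))" by (simp add: exp_add[symmetric])
  also have "\<dots> \<le> exp (- (2 * ln n))"
  proof -
    \<comment> \<open>Shows \<open>ln n \<le> b * l\<close>: here \<open>ln n = ln b + l\<close>,
      and \<open>ln b \<le> b - 1 \<le> (b - 1) * l\<close> because
      \<open>l \<ge> 1\<close>.\<close>
    have "(real b - 1) * 1 \<le> (real b - 1) * l" using l1 b by (intro mult_left_mono) auto
    moreover have "ln (real b) \<le> real b - 1" using b by (intro ln_le_minus_one) auto
    moreover have "ln n = ln b + l" using b n by (simp add: l_def ln_div)
    ultimately have "ln n \<le> b * l" by (simp add: algebra_simps)
    then show ?thesis by simp
  qed
  also have "\<dots> = 1 / (real n)\<^sup>2"
    using n by (simp add: exp_minus exp_double field_simps)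
  finally show ?thesis .
qed

section \<open>Deterministic shrinking of the Blue set\<close>

definition red_set :: "'a set \<Rightarrow> 'a set set \<Rightarrow> 'a set \<Rightarrow> nat \<Rightarrow> 'a set" where
  "red_set V F R t = {v \<in> V. majority_dynamics F R t v = Red}"

lemma blue_Suc_imp_blue_majority:
  assumes F: "F \<subseteq> nsets V 2" and v: "v \<in> V - red_set V F R (Suc t)"
  shows "card (neighbors F v \<inter> red_set V F R t) \<le> card (neighbors F v - red_set V F R t)"
proof -
  let ?c = "majority_dynamics F R t"
  have N: "neighbors F v \<subseteq> V" using neighbors_neq[OF F, of _ v] by auto
  have "{u \<in> neighbors F v. ?c u = Red} = neighbors F v \<inter> red_set V F R t"
    "{u \<in> neighbors F v. ?c u \<noteq> Red} = neighbors F v - red_set V F R t"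
    using N by (auto simp: red_set_def)
  moreover have "majority_step F ?c v \<noteq> Red" using v by (auto simp: red_set_def majority_dynamics_def)
  ultimately show ?thesis using not_majority_step_RedD[of F ?c v] by simp
qed

text \<open>The hypotheses are negated bad events, each excluding sets of one exact size. If too
  many vertices were Blue, a subset of that size would be such a bad set; this is applied to days 2
  and 3 and then to every further day.\<close>

lemma blue_card_decay:
  fixes r :: real
  assumes V: "finite V" "card V = n" and F: "F \<subseteq> nsets V 2"
    and day1: "real n / 2 + D\<^sub>1 \<le> real (card (red_set V F R 1))"
    and day2: "\<not> (\<exists>R S. R \<subseteq> V \<and> S \<subseteq> V \<and> real n / 2 + D\<^sub>1 \<le> real (card R) \<and> card S = m\<^sub>1 \<and>
      (\<forall>v\<in>S. card (neighbors F v \<inter> R) \<le> card (neighbors F v - R)))"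
    and m1: "real m\<^sub>1 \<le> real n / 2 - D\<^sub>2 + 1"
    and day3: "\<not> (\<exists>R S. R \<subseteq> V \<and> S \<subseteq> V \<and> real n / 2 + D\<^sub>2 \<le> real (card R) \<and> card S = m\<^sub>2 \<and>
      (\<forall>v\<in>S. card (neighbors F v \<inter> R) \<le> card (neighbors F v - R)))"
    and deg: "\<not> (\<exists>v\<in>V. real (card (neighbors F v)) \<le> c)" and c: "0 \<le> c"
    and shrink: "\<not> (\<exists>b\<in>{1..m\<^sub>2}. \<exists>B S. B \<subseteq> V \<and> S \<subseteq> V \<and> card B = b \<and> card S = nat \<lceil>b / r\<rceil> \<and>
      (\<forall>v\<in>S. c / 2 \<le> real (card (neighbors F v \<inter> B))))" and r: "1 \<le> r"
  shows "real (card (V - red_set V F R (3 + t))) \<le> m\<^sub>2 / r ^ t"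
proof -
  let ?red = "red_set V F R"
  have sub: "?red t \<subseteq> V" for t by (auto simp: red_set_def)
  have fin: "finite (?red t)" for t using sub V(1) by (rule finite_subset)
  have few: "card (V - ?red (Suc t)) < m"
    if "\<not> (\<exists>R S. R \<subseteq> V \<and> S \<subseteq> V \<and> real n / 2 + D \<le> real (card R) \<and> card S = m \<and>
      (\<forall>v\<in>S. card (neighbors F v \<inter> R) \<le> card (neighbors F v - R)))" "real n / 2 + D \<le> real (card (?red t))" for t m D
  proof (rule ccontr)
    assume "\<not> ?thesis"
    then obtain S where S: "S \<subseteq> V - ?red (Suc t)" "card S = m"
      using obtain_subset_with_card_n[of m "V - ?red (Suc t)"] by auto
    have "\<forall>v\<in>S. card (neighbors F v \<inter> ?red t) \<le> card (neighbors F v - ?red t)"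
      using S blue_Suc_imp_blue_majority[OF F] by blast
    then show False using that S sub[of t] by blast
  qed
  have "card (V - ?red 2) < m\<^sub>1"
    using few[OF day2, of 1] day1 by (simp add: numeral_2_eq_2)
  moreover have "card (V - ?red 2) = n - card (?red 2)"
    using V fin sub by (simp add: card_Diff_subset)
  moreover have "card (?red 2) \<le> n" using V sub card_mono by metis
  \<comment> \<open>The \<open>+ 1\<close> in the bound on \<open>m\<^sub>1\<close> is recovered
    here, since the number of Blue vertices is strictly below \<open>m\<^sub>1\<close>.\<close>
  ultimately have "real n / 2 + D\<^sub>2 \<le> real (card (?red 2))" using m1 by linarith
  then have start: "card (V - ?red 3) < m\<^sub>2"
    using few[OF day3, of 2] by (simp add: numeral_3_eq_3 numeral_2_eq_2)
  have step: "real (card (V - ?red (Suc t))) \<le> real (card (V - ?red t)) / r"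
    if le: "card (V - ?red t) \<le> m\<^sub>2" for t
  proof -
    define B where "B = V - ?red t"
    \<comment> \<open>The positivity clause settles an empty \<open>B\<close>, which the shrinking
      hypothesis leaves out because it starts at \<open>b = 1\<close>.\<close>
    have half: "c / 2 \<le> real (card (neighbors F v \<inter> B)) \<and> 0 < card (neighbors F v \<inter> B)"
      if v: "v \<in> V - ?red (Suc t)" for v
    proof -
      have N: "neighbors F v \<subseteq> V" using neighbors_neq[OF F, of _ v] by auto
      have "neighbors F v - ?red t = neighbors F v \<inter> B" using N by (auto simp: B_def)
      then have "card (neighbors F v \<inter> ?red t) \<le> card (neighbors F v \<inter> B)"
        using blue_Suc_imp_blue_majority[OF F v] by simp
      moreover have "card (neighbors F v) = card (neighbors F v \<inter> ?red t) + card (neighbors F v \<inter> B)"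
      proof -
        have "neighbors F v = (neighbors F v \<inter> ?red t) \<union> (neighbors F v \<inter> B)" using N by (auto simp: B_def)
        moreover have "card ((neighbors F v \<inter> ?red t) \<union> (neighbors F v \<inter> B)) =
            card (neighbors F v \<inter> ?red t) + card (neighbors F v \<inter> B)"
          using finite_neighbors[OF V(1) F] by (intro card_Un_disjoint) (auto simp: B_def)
        ultimately show ?thesis by simp
      qed
      moreover have "c < real (card (neighbors F v))" using deg v by force
      ultimately show ?thesis using c by linarith
    qed
    show ?thesis
    proof (cases "B = {}")
      case True
      then have "card (V - ?red (Suc t)) = 0" using half by (intro card_eq_0_iff[THEN iffD2]) auto
      then show ?thesis using r by simp
    next
      case False
      then have B: "1 \<le> card B" "card B \<le> m\<^sub>2" using le V card_gt_0_iff[of B] by (auto simp: B_def Suc_le_eq)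
      have "card (V - ?red (Suc t)) < nat \<lceil>card B / r\<rceil>"
      proof (rule ccontr)
        assume "\<not> ?thesis"
        then obtain S where S: "S \<subseteq> V - ?red (Suc t)" "card S = nat \<lceil>card B / r\<rceil>"
          using obtain_subset_with_card_n[of "nat \<lceil>card B / r\<rceil>" "V - ?red (Suc t)"] by (metis not_less)
        then have "\<forall>v\<in>S. c / 2 \<le> real (card (neighbors F v \<inter> B))" using half by blast
        moreover have "B \<subseteq> V" "S \<subseteq> V" "card B \<in> {1..m\<^sub>2}" using B S by (auto simp: B_def)
        ultimately show False using shrink S(2) by blast
      qed
      \<comment> \<open>An integer strictly below the ceiling of a real number is strictly below
        that number.\<close>
      then show ?thesis unfolding B_def by linarith
    qed
  qed
  show ?thesis
  proof (induction t)
    case 0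
    then show ?case using start by simp
  next
    case (Suc t)
    have "m\<^sub>2 / r ^ t \<le> m\<^sub>2 / 1" using r by (intro divide_left_mono) auto
    then have "card (V - ?red (3 + t)) \<le> m\<^sub>2" using Suc by simp
    then have "real (card (V - ?red (Suc (3 + t)))) \<le> real (card (V - ?red (3 + t))) / r" by (rule step)
    also have "\<dots> \<le> m\<^sub>2 / r ^ t / r" using Suc r by (intro divide_right_mono) auto
    finally show ?case by (simp add: mult.commute)
  qed
qed

section \<open>Assembly of the probability bound\<close>

lemma log_time_suffices:
  assumes z: "1 < z" "z \<le> n" and m: "real m \<le> n"
  shows "\<exists>t. real (3 + t) \<le> 6 * log z n \<and> m / sqrt z ^ t < 1"
proof (intro exI conjI)
  define l where "l = log z n"
  \<comment> \<open>Each day divides by \<open>sqrt z\<close>, so more than \<open>2 * l\<close>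
    days beat n = z^l. As \<open>l \<ge> 1\<close>, the total \<open>3 + t \<le> 2 * l + 4\<close>
    is at most \<open>6 * l\<close>.\<close>
  define t where "t = nat \<lfloor>2 * l\<rfloor> + 1"
  have l: "1 \<le> l" using z by (simp add: l_def)
  have t: "2 * l < t" "t \<le> 2 * l + 1" using l unfolding t_def by linarith+
  show "real (3 + t) \<le> 6 * log z n" using t l unfolding l_def[symmetric] by simp
  have "n = z powr l" using z by (simp add: l_def)
  also have "\<dots> = sqrt z powr (2 * l)" using z by (simp add: powr_half_sqrt[symmetric] powr_powr)
  also have "\<dots> < sqrt z powr t" using z t by (intro powr_less_mono) auto
  also have "\<dots> = sqrt z ^ t" using z by (simp add: powr_realpow)
  finally have "m < sqrt z ^ t" using m by simp
  then show "m / sqrt z ^ t < 1" using z by simp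
qed

text \<open>Five bad events are excluded: a poor day 1, failures on days 2 and 3, a low degree, and
  a failure of shrinking. The term \<open>3 / n\<close> collects the second, third and
  fifth.\<close>

lemma prob_unanimity_ge:
  fixes V :: "'a set" and p \<Delta> r \<epsilon> \<tau> \<delta> \<eta> :: real
  assumes V: "finite V" "R \<union> B = V" "R \<inter> B = {}" and n: "card V = n" and card: "real (card R) = real n / 2 + \<Delta>"
    and p: "0 < p" "p \<le> 1" and \<Delta>: "10 \<le> p * \<Delta>"
    and r: "r = sqrt (p * n)" "45 \<le> r" and \<epsilon>: "0 < \<epsilon>" "96 / \<epsilon> \<le> r"
    and \<tau>: "0 \<le> \<tau>" "\<tau> * \<epsilon> + exp (- \<tau>) \<le> \<delta>"
    and n1: "10000 \<le> n" "exp (- (11 / 125 * real n)) \<le> 1 / n"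
    and m2: "10000 / p + 1 \<le> \<eta> * n" and \<eta>: "0 < \<eta>" "\<eta> \<le> exp (- 1)" "\<eta> \<le> (\<epsilon> / 8)\<^sup>2"
  shows "1 - (512 / min n (p * \<Delta>\<^sup>2) + 3 / n + exp 1 * (n * exp (- ((1 - \<delta>) * (p * n)))))
    \<le> measure_pmf.prob (erdos_renyi V p) {E. red_unanimity_within V E R (6 * log (p * n) n)}"
proof -
  let ?E = "nsets V 2"
  \<comment> \<open>\<open>D\<^sub>1\<close> is the excess reached on day 1.
    \<open>D\<^sub>2\<close> is what remains when fewer than \<open>m\<^sub>1\<close>, about 0.48 n,
    vertices are Blue on day 2, and \<open>m\<^sub>2\<close> bounds the Blue set of day 3.\<close>
  define D\<^sub>1 where "D\<^sub>1 = 2 * real n / r"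
  define D\<^sub>2 where "D\<^sub>2 = real n / 50"
  define m\<^sub>1 where "m\<^sub>1 = nat \<lceil>12 / 25 * real n\<rceil>"
  define m\<^sub>2 where "m\<^sub>2 = nat \<lceil>10000 / p\<rceil>"
  define A\<^sub>1 where "A\<^sub>1 F \<longleftrightarrow> card {v \<in> V. majority_step F (initial_coloring R) v = Red} < real n / 2 + D\<^sub>1" for F
  define A where "A D m F \<longleftrightarrow> (\<exists>R S. R \<subseteq> V \<and> S \<subseteq> V \<and> real n / 2 + D \<le> real (card R) \<and> card S = m \<and>
      (\<forall>v\<in>S. card (neighbors F v \<inter> R) \<le> card (neighbors F v - R)))" for D and m :: nat and F
  define A\<^sub>4 where "A\<^sub>4 F \<longleftrightarrow> (\<exists>v\<in>V. real (card (neighbors F v)) \<le> \<epsilon> * (p * n))" for F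
  define A\<^sub>5 where "A\<^sub>5 F \<longleftrightarrow> (\<exists>b\<in>{1..m\<^sub>2}. \<exists>B S. B \<subseteq> V \<and> S \<subseteq> V \<and> card B = b \<and> card S = nat \<lceil>b / r\<rceil> \<and>
      (\<forall>v\<in>S. \<epsilon> * (p * n) / 2 \<le> real (card (neighbors F v \<inter> B))))" for F
  have finE: "finite ?E" using V(1) by (rule finite_imp_finite_nsets)
  have p': "0 \<le> p" "p \<le> 1" using p by auto
  have n0: "0 < real n" using n1 by simp
  have r2: "r\<^sup>2 = p * n" using r p by simp
  have r0: "0 < r" "1 \<le> r" using r(2) by linarith+
  have "0 \<le> 10000 / p" using p by simp
  then have "real m\<^sub>2 \<le> 10000 / p + 1" unfolding m\<^sub>2_def by linarith
  then have m2n: "real m\<^sub>2 \<le> \<eta> * n" using m2 by linarith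
  have "exp (- 1) \<le> (1::real)" by simp
  then have "\<eta> * n \<le> 1 * real n" using \<eta>(2) by (intro mult_right_mono) linarith+
  then have m2n': "real m\<^sub>2 \<le> n" using m2n by linarith
  have P1: "Esub p ?E (\<lambda>F. of_bool (A\<^sub>1 F)) \<le> 512 / min n (p * \<Delta>\<^sup>2)"
    unfolding A\<^sub>1_def D\<^sub>1_def by (rule prob_few_red_after_first_step) (use V n card p \<Delta> r in auto)
  have P2: "Esub p ?E (\<lambda>F. of_bool (A D\<^sub>1 m\<^sub>1 F)) \<le> 1 / n"
  proof -
    \<comment> \<open>With this excess every Blue vertex contributes at least 31/10 to the exponent.
      Over 0.48 n vertices this gives 186/125 n, which beats the 7/5 n from counting pairs by 11/125
      n.\<close>
    have D1: "9 / 10 * D\<^sub>1\<^sup>2 / n = 18 / 5 / p"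
      using n0 p r2 unfolding D\<^sub>1_def by (simp add: power_divide power_mult_distrib power2_eq_square field_simps)
    have "400 * real n \<le> (9 * r) * real n" using r(2) by (intro mult_right_mono) auto
    then have D1n: "0 \<le> D\<^sub>1" "D\<^sub>1 \<le> 9 / 200 * n" using r0 by (auto simp: D\<^sub>1_def field_simps)
    have "Esub p ?E (\<lambda>F. of_bool (A D\<^sub>1 m\<^sub>1 F)) \<le> exp (7 / 5 * n + p * m\<^sub>1 * (1 / 2 - 9 / 10 * D\<^sub>1\<^sup>2 / n))"
      unfolding A_def using n V(1) p' D1n by (intro prob_exists_blue_majority_on) auto
    also have "p * m\<^sub>1 * (1 / 2 - 9 / 10 * D\<^sub>1\<^sup>2 / n) = m\<^sub>1 * (p / 2 - 18 / 5)"
      unfolding D1 using p by (simp add: field_simps)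
    also have "\<dots> \<le> m\<^sub>1 * (- 31 / 10)" using p by (intro mult_left_mono) auto
    also have "\<dots> \<le> - (186 / 125 * n)" unfolding m\<^sub>1_def by linarith
    finally have "Esub p ?E (\<lambda>F. of_bool (A D\<^sub>1 m\<^sub>1 F)) \<le> exp (- (11 / 125 * real n))"
      by (simp add: algebra_simps)
    then show ?thesis using n1 by linarith
  qed
  have P3: "Esub p ?E (\<lambda>F. of_bool (A D\<^sub>2 m\<^sub>2 F)) \<le> 1 / n"
  proof -
    \<comment> \<open>For \<open>n \<ge> 10000\<close> the bracket is at most
      \<open>- 3 / 10000 * n\<close>; multiplied by \<open>p * m\<^sub>2 \<ge> 10000\<close> it
      gives -3 n against 7/5 n.\<close>
    have D2: "9 / 10 * D\<^sub>2\<^sup>2 / n = 9 / 25000 * n"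
      using n0 unfolding D\<^sub>2_def by (simp add: power2_eq_square field_simps)
    have pm: "10000 \<le> p * m\<^sub>2"
    proof -
      have "10000 / p \<le> m\<^sub>2" unfolding m\<^sub>2_def by linarith
      then show ?thesis using p by (simp add: field_simps)
    qed
    have "Esub p ?E (\<lambda>F. of_bool (A D\<^sub>2 m\<^sub>2 F)) \<le> exp (7 / 5 * n + p * m\<^sub>2 * (1 / 2 - 9 / 10 * D\<^sub>2\<^sup>2 / n))"
      unfolding A_def using n V(1) p'
      by (intro prob_exists_blue_majority_on) (auto simp: D\<^sub>2_def)
    also have "p * m\<^sub>2 * (1 / 2 - 9 / 10 * D\<^sub>2\<^sup>2 / n) \<le> p * m\<^sub>2 * (- 3 / 10000 * n)"
      unfolding D2 using n1 p by (intro mult_left_mono) auto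
    also have "\<dots> = - (p * m\<^sub>2 * (3 / 10000 * n))" by simp
    also have "\<dots> \<le> - (10000 * (3 / 10000 * n))"
      using pm by (intro le_imp_neg_le mult_right_mono) auto
    finally have "Esub p ?E (\<lambda>F. of_bool (A D\<^sub>2 m\<^sub>2 F)) \<le> exp (7 / 5 * n - 3 * n)"
      by simp
    also have "\<dots> \<le> exp (- (11 / 125 * real n))" by simp
    finally show ?thesis using n1 by linarith
  qed
  have P4: "Esub p ?E (\<lambda>F. of_bool (A\<^sub>4 F)) \<le> exp 1 * (n * exp (- ((1 - \<delta>) * (p * n))))"
    unfolding A\<^sub>4_def using V n p' \<tau> n1 by (intro prob_exists_low_degree) auto
  \<comment> \<open>A union over at most n sizes \<open>b\<close>, each failing with probability at
    most 1/n^2. The bounds on \<open>\<eta>\<close> supply both lower bounds on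
    \<open>ln (n / b)\<close>.\<close>
  have P5: "Esub p ?E (\<lambda>F. of_bool (A\<^sub>5 F)) \<le> 1 / n"
  proof -
    have "Esub p ?E (\<lambda>F. of_bool (A\<^sub>5 F)) \<le> real (card {1..m\<^sub>2}) * (1 / (real n)\<^sup>2)"
      unfolding A\<^sub>5_def
    proof (rule Esub_union_bound[OF p'])
      fix b assume b: "b \<in> {1..m\<^sub>2}"
      then have b0: "0 < real b" "1 \<le> b" "b \<le> \<eta> * n" using m2n by auto
      then have "1 / \<eta> \<le> n / b" using \<eta> by (simp add: field_simps)
      then have "ln (1 / \<eta>) \<le> ln (n / b)" using \<eta> n0 b0 by (subst ln_le_cancel_iff) auto
      then have lb: "- ln \<eta> \<le> ln (n / b)" using \<eta> by (simp add: ln_div)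
      have "ln \<eta> \<le> - 1" using \<eta> ln_le_cancel_iff[of \<eta> "exp (- 1)"] by simp
      moreover have "ln \<eta> \<le> - (2 * ln (8 / \<epsilon>))"
        using \<eta> \<epsilon> ln_le_cancel_iff[of \<eta> "(\<epsilon> / 8)\<^sup>2"] by (simp add: ln_realpow ln_div)
      ultimately show "Esub p ?E (\<lambda>F. of_bool (\<exists>B S. B \<subseteq> V \<and> S \<subseteq> V \<and> card B = b \<and> card S = nat \<lceil>b / r\<rceil> \<and>
          (\<forall>v\<in>S. \<epsilon> * (p * n) / 2 \<le> real (card (neighbors F v \<inter> B))))) \<le> 1 / (real n)\<^sup>2"
        using lb V(1) n p' b0 n0 \<epsilon> r r0 by (intro prob_exists_shrink_failure) auto
    qed simp
    also have "\<dots> \<le> n * (1 / (real n)\<^sup>2)" using m2n' by (intro mult_right_mono) auto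
    finally show ?thesis using n0 by (simp add: power2_eq_square)
  qed
  define U where "U F \<longleftrightarrow> F \<in> {E. red_unanimity_within V E R (6 * log (p * n) n)}" for F
  have good: "U F" if F: "F \<subseteq> ?E" and bad: "\<not> A\<^sub>1 F" "\<not> A D\<^sub>1 m\<^sub>1 F" "\<not> A D\<^sub>2 m\<^sub>2 F" "\<not> A\<^sub>4 F" "\<not> A\<^sub>5 F" for F
  proof -
    have decay: "real (card (V - red_set V F R (3 + t))) \<le> m\<^sub>2 / r ^ t" for t
    proof (rule blue_card_decay[OF V(1) n F])
      show "real n / 2 + D\<^sub>1 \<le> real (card (red_set V F R 1))"
        using bad(1) by (simp add: A\<^sub>1_def red_set_def majority_dynamics_def)
      show "real m\<^sub>1 \<le> real n / 2 - D\<^sub>2 + 1" unfolding m\<^sub>1_def D\<^sub>2_def by linarith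
      show "0 \<le> \<epsilon> * (p * n)" using \<epsilon> p by simp
      show "1 \<le> r" by (rule r0)
    qed (use bad in \<open>unfold A_def A\<^sub>4_def A\<^sub>5_def, blast+\<close>)
    have "1 < r\<^sup>2" using r(2) by (intro one_less_power) auto
    then have "1 < p * n" using r2 by simp
    moreover have "p * n \<le> n" using p n0 by simp
    ultimately obtain t where t: "real (3 + t) \<le> 6 * log (p * n) n" "m\<^sub>2 / r ^ t < 1"
      using log_time_suffices[of "p * n" n m\<^sub>2] m2n' r(1) by auto
    have "card (V - red_set V F R (3 + t)) = 0" using decay[of t] t(2) by linarith
    then have "V - red_set V F R (3 + t) = {}" using V(1) by simp
    then have "\<forall>v\<in>V. majority_dynamics F R (3 + t) v = Red" by (auto simp: red_set_def)
    then show ?thesis using t(1) unfolding U_def red_unanimity_within_def by blast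
  qed
  have "1 - (Esub p ?E (\<lambda>F. of_bool (A\<^sub>1 F)) + Esub p ?E (\<lambda>F. of_bool (A D\<^sub>1 m\<^sub>1 F)) + Esub p ?E (\<lambda>F. of_bool (A D\<^sub>2 m\<^sub>2 F)) +
      Esub p ?E (\<lambda>F. of_bool (A\<^sub>4 F)) + Esub p ?E (\<lambda>F. of_bool (A\<^sub>5 F))) =
    Esub p ?E (\<lambda>F. 1 - (of_bool (A\<^sub>1 F) + of_bool (A D\<^sub>1 m\<^sub>1 F) + of_bool (A D\<^sub>2 m\<^sub>2 F) + of_bool (A\<^sub>4 F) + of_bool (A\<^sub>5 F)))"
    using finE by (simp only: Esub_diff Esub_add Esub_const)
  also have "\<dots> \<le> Esub p ?E (\<lambda>F. of_bool (U F))"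
  proof (intro Esub_mono p')
    fix F assume "F \<subseteq> ?E"
    then show "1 - (of_bool (A\<^sub>1 F) + of_bool (A D\<^sub>1 m\<^sub>1 F) + of_bool (A D\<^sub>2 m\<^sub>2 F) + of_bool (A\<^sub>4 F) + of_bool (A\<^sub>5 F)) \<le> (of_bool (U F) :: real)"
      using good[of F] by (auto simp: of_bool_def)
  qed
  also have "\<dots> = measure_pmf.prob (erdos_renyi V p) {E. red_unanimity_within V E R (6 * log (p * n) n)}"
    unfolding U_def using V(1) p' by (rule prob_erdos_renyi[symmetric])
  finally show ?thesis using P1 P2 P3 P4 P5 by (simp add: field_simps)
qed

section \<open>Choice of parameters and conclusion\<close>

text \<open>Collects what is required of large n. Because \<open>p * n \<ge> ln n\<close>, the last
  clause yields \<open>10000 / p + 1 \<le> \<eta> * n\<close> uniformly in \<open>p\<close>.\<close>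

lemma eventually_large_n:
  assumes "0 < (\<eta> :: real)"
  shows "\<forall>\<^sub>F n in sequentially. K \<le> ln (real n) \<and> 10000 \<le> n \<and> exp (- (11 / 125 * real n)) \<le> 1 / n \<and>
    10000 / ln n + 1 / n \<le> \<eta>"
proof (intro eventually_conj)
  show "\<forall>\<^sub>F n in sequentially. K \<le> ln (real n)"
    using filterlim_compose[OF ln_at_top filterlim_real_sequentially] by (simp add: filterlim_at_top)
  show "\<forall>\<^sub>F n in sequentially. 10000 \<le> (n::nat)" by (rule eventually_ge_at_top)
  show "\<forall>\<^sub>F n in sequentially. exp (- (11 / 125 * real n)) \<le> 1 / n" by real_asymp
  have "(\<lambda>n. 10000 / ln (real n) + 1 / real n) \<longlonglongrightarrow> 0" by real_asymp
  then have "\<forall>\<^sub>F n in sequentially. 10000 / ln (real n) + 1 / real n < \<eta>"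
    using assms by (rule order_tendstoD(2))
  then show "\<forall>\<^sub>F n in sequentially. 10000 / ln (real n) + 1 / real n \<le> \<eta>"
    by eventually_elim simp
qed

theorem theorem1p2:
  fixes lam :: real
  assumes "lam > 0"
  shows "\<exists>(C1 :: real) > 0. \<exists>(C2 :: real) > 0. \<exists>n0 :: nat. \<forall>n \<ge> n0.
    \<forall>(V :: nat set) R B (p :: real) (Delta :: real).
      finite V \<and> card V = n \<and> R \<union> B = V \<and> R \<inter> B = {} \<and>
      real (card R) = real n / 2 + Delta \<and>
      0 \<le> p \<and> p \<le> 1 \<and>
      real n - 10 \<ge> p * real n \<and> p * real n \<ge> (1 + lam) * ln (real n) \<and>
      p * Delta \<ge> 10 \<longrightarrow>
      measure_pmf.prob (erdos_renyi V p)
        {E. red_unanimity_within V E R (C1 * log (p * real n) (real n))}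
      \<ge> 1 - C2 * (1 / min (real n) (p * Delta\<^sup>2) + real n powr (- lam / 2))"
proof -
  \<comment> \<open>This value makes \<open>(1 - \<delta>) * (1 + lam) = 1 + lam / 2\<close>, so the
    low-degree bound becomes a multiple of \<open>n powr (- lam / 2)\<close>. Then
    \<open>\<tau>\<close> and \<open>\<epsilon>\<close> are chosen so that
    \<open>exp (- \<tau>)\<close> and \<open>\<tau> * \<epsilon>\<close> both equal
    \<open>\<delta> / 2\<close>.\<close>
  define \<delta> where "\<delta> = lam / (2 * (1 + lam))"
  define \<tau> where "\<tau> = ln (2 / \<delta>)"
  define \<epsilon> where "\<epsilon> = \<delta> / (2 * \<tau>)"
  define \<eta> where "\<eta> = min (exp (- 1)) ((\<epsilon> / 8)\<^sup>2)"
  \<comment> \<open>Since \<open>p * n \<ge> ln n \<ge> K\<close>, the root of \<open>p * n\<close>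
    is at least both 45 and \<open>96 / \<epsilon>\<close>.\<close>
  define K where "K = max (45\<^sup>2) ((96 / \<epsilon>)\<^sup>2)"
  have \<delta>: "0 < \<delta>" "\<delta> < 1" using assms by (auto simp: \<delta>_def)
  then have \<tau>: "0 < \<tau>" by (simp add: \<tau>_def)
  have \<epsilon>: "0 < \<epsilon>" using \<delta> \<tau> by (simp add: \<epsilon>_def)
  have \<eta>: "0 < \<eta>" "\<eta> \<le> exp (- 1)" "\<eta> \<le> (\<epsilon> / 8)\<^sup>2" using \<epsilon> by (auto simp: \<eta>_def)
  have "exp (- \<tau>) = \<delta> / 2" using \<delta> by (simp add: \<tau>_def exp_minus)
  moreover have "\<tau> * \<epsilon> = \<delta> / 2" using \<tau> by (simp add: \<epsilon>_def)
  ultimately have \<tau>\<epsilon>: "\<tau> * \<epsilon> + exp (- \<tau>) \<le> \<delta>" by simp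
  obtain n0 where n0: "\<And>n. n0 \<le> n \<Longrightarrow> K \<le> ln (real n) \<and> 10000 \<le> n \<and> exp (- (11 / 125 * real n)) \<le> 1 / n \<and>
      10000 / ln n + 1 / n \<le> \<eta>"
    using eventually_large_n[OF \<eta>(1), of K] unfolding eventually_sequentially by blast
  have main: "1 - 515 * (1 / min (real n) (p * Delta\<^sup>2) + real n powr (- lam / 2)) \<le>
      measure_pmf.prob (erdos_renyi V p) {E. red_unanimity_within V E R (6 * log (p * real n) (real n))}"
    if n: "n0 \<le> n" and V: "finite V" "card V = n" "R \<union> B = V" "R \<inter> B = {}"
      and card: "real (card R) = real n / 2 + Delta" and p: "0 \<le> p" "p \<le> 1"
      and pn: "p * real n \<ge> (1 + lam) * ln (real n)" and Delta: "p * Delta \<ge> 10"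
    for n and V R B :: "nat set" and p Delta :: real
  proof -
    have big: "K \<le> ln (real n)" "10000 \<le> n" "exp (- (11 / 125 * real n)) \<le> 1 / n" "10000 / ln n + 1 / n \<le> \<eta>"
      using n0[OF n] by auto
    have npos: "0 < real n" using big by simp
    have "0 \<le> K" by (simp add: K_def)
    then have ln0: "0 < ln (real n)" using big(2) by simp
    have pln: "ln (real n) \<le> p * n" using pn ln0 assms by (smt (verit) mult_less_cancel_right2)
    then have p0: "0 < p" using ln0 npos p by (smt (verit) mult_not_zero)
    have rK: "sqrt K \<le> sqrt (p * n)" using pln big by simp
    have "45 \<le> sqrt K" by (rule real_le_rsqrt) (simp add: K_def)
    then have r45: "45 \<le> sqrt (p * n)" using rK by linarith
    have "96 / \<epsilon> \<le> sqrt K" by (rule real_le_rsqrt) (simp add: K_def)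
    then have r96: "96 / \<epsilon> \<le> sqrt (p * n)" using rK by linarith
    have "10000 / p + 1 = n * (10000 / (p * n) + 1 / n)" using npos p0 by (simp add: field_simps)
    also have "\<dots> \<le> n * (10000 / ln n + 1 / n)"
      using pln ln0 npos p0 by (intro mult_left_mono add_right_mono divide_left_mono) auto
    also have "\<dots> \<le> n * \<eta>" using big npos by (intro mult_left_mono) auto
    finally have m2: "10000 / p + 1 \<le> \<eta> * n" by (simp add: mult.commute)
    have deg: "exp 1 * (n * exp (- ((1 - \<delta>) * (p * n)))) \<le> 3 * real n powr (- lam / 2)"
    proof -
      have "(1 - \<delta>) * (1 + lam) = 1 + lam / 2" using assms by (simp add: \<delta>_def field_simps)
      then have "(1 + lam / 2) * ln n = (1 - \<delta>) * ((1 + lam) * ln n)" by simp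
      also have "\<dots> \<le> (1 - \<delta>) * (p * n)" using pn \<delta> by (intro mult_left_mono) auto
      finally have "n * exp (- ((1 - \<delta>) * (p * n))) \<le> n * exp (- ((1 + lam / 2) * ln n))"
        by (intro mult_left_mono) auto
      also have "\<dots> = exp (ln n) * exp (- ((1 + lam / 2) * ln n))" using npos by simp
      also have "\<dots> = exp (ln n + - ((1 + lam / 2) * ln n))" by (rule exp_add[symmetric])
      also have "ln n + - ((1 + lam / 2) * ln n) = - lam / 2 * ln n" by (simp add: algebra_simps)
      also have "exp \<dots> = real n powr (- lam / 2)" using npos by (simp add: powr_def)
      finally show ?thesis using exp_le by (intro mult_mono) auto
    qed
    have D0: "0 < Delta" using p0 Delta by (smt (verit) mult_nonneg_nonpos)
    define M where "M = min (real n) (p * Delta\<^sup>2)"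
    have M: "0 < M" "M \<le> n" using npos p0 D0 by (auto simp: M_def)
    \<comment> \<open>As M is at most n, the errors of order 1/n merge with \<open>512 / M\<close>
      into \<open>515 / M\<close>; the low-degree term has factor 3, also below 515.\<close>
    then have "3 / n \<le> 3 / M" using npos by (intro divide_left_mono) auto
    moreover have "512 / M + 3 / M = 515 * (1 / M)" by (simp add: add_divide_distrib[symmetric])
    ultimately have "512 / M + 3 / n + exp 1 * (n * exp (- ((1 - \<delta>) * (p * n)))) \<le>
        515 * (1 / M + real n powr (- lam / 2))"
      unfolding distrib_left using deg powr_ge_zero[of "real n" "- lam / 2"] by linarith
    moreover have "1 - (512 / M + 3 / n + exp 1 * (n * exp (- ((1 - \<delta>) * (p * n)))))
      \<le> measure_pmf.prob (erdos_renyi V p) {E. red_unanimity_within V E R (6 * log (p * n) n)}"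
      unfolding M_def using V card p0 p Delta r45 r96 \<epsilon> \<tau> \<tau>\<epsilon> big(2,3) m2 \<eta>
      by (intro prob_unanimity_ge[where r = "sqrt (p * n)" and \<tau> = \<tau> and \<epsilon> = \<epsilon> and \<eta> = \<eta> and B = B]) auto
    ultimately show ?thesis unfolding M_def by linarith
  qed
  show ?thesis
    by (intro exI[of _ 6] exI[of _ 515] conjI exI[of _ n0]) (use main in auto)
qed

end
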